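(* Let $\mathbb{F}$ be a field of characteristic $0$ and let $n\in\mathbb{N}$ be any positive integer. Then every $2$-local automorphism of the Witt algebra $W_n=\mathrm{Der}(\mathbb{F}[t_1^{\pm1},\ldots,t_n^{\pm1}])$ is an automorphism of the Lie algebra $W_n$, and every local automorphism of $W_n$ is an automorphism of the Lie algebra $W_n$.
   Context: $W_n=\mathrm{Der}(\mathbb{F}[t_1^{\pm1},\ldots,t_n^{\pm1}])$ is the Lie algebra (under the commutator bracket) of $\mathbb{F}$-linear derivations of the Laurent polynomial algebra in $n$ variables over $\mathbb{F}$. An automorphism of a Lie algebra $L$ is an invertible linear map $\theta:L\to L$ with $\theta([x,y])=[\theta(x),\theta(y)]$ for all $x,y\in L$. A local automorphism of $L$ is a linear map $\Phi:L\to L$ such that for every $x\in L$ there is an automorphism $\theta_x$ of $L$ with $\Phi(x)=\theta_x(x)$. A $2$-local automorphism of $L$ is a map $\Phi:L\to L$ (not necessarily linear) such that for every $x,y\in L$ there is an automorphism $\theta_{x,y}$ of $L$ with $\Phi(x)=\theta_{x,y}(x)$ and $\Phi(y)=\theta_{x,y}(y)$. Neither kind of map is assumed to be invertible. *)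

theory Defs
  imports "HOL-Analysis.Finite_Cartesian_Product" "HOL-Library.Poly_Mapping"
begin

section \<open>Lie algebras and their (local, 2-local) automorphisms\<close>

locale lie_algebra = vector_space smul
  for smul :: "'f::field \<Rightarrow> 'l::ab_group_add \<Rightarrow> 'l" +
  fixes bracket :: "'l \<Rightarrow> 'l \<Rightarrow> 'l"
  assumes bracket_linear_left: "Vector_Spaces.linear smul smul (\<lambda>x. bracket x y)"
    and bracket_linear_right: "Vector_Spaces.linear smul smul (bracket x)"
    and bracket_self: "bracket x x = 0"
    and jacobi: "bracket x (bracket y z) + bracket y (bracket z x) + bracket z (bracket x y) = 0"

definition lie_automorphism ::
  "('f::field \<Rightarrow> 'l::ab_group_add \<Rightarrow> 'l) \<Rightarrow> ('l \<Rightarrow> 'l \<Rightarrow> 'l) \<Rightarrow> ('l \<Rightarrow> 'l) \<Rightarrow> bool" where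
  "lie_automorphism smul bracket \<theta> \<longleftrightarrow>
     Vector_Spaces.linear smul smul \<theta> \<and> bij \<theta> \<and>
     (\<forall>x y. \<theta> (bracket x y) = bracket (\<theta> x) (\<theta> y))"

definition local_lie_automorphism ::
  "('f::field \<Rightarrow> 'l::ab_group_add \<Rightarrow> 'l) \<Rightarrow> ('l \<Rightarrow> 'l \<Rightarrow> 'l) \<Rightarrow> ('l \<Rightarrow> 'l) \<Rightarrow> bool" where
  "local_lie_automorphism smul bracket \<Phi> \<longleftrightarrow>
     Vector_Spaces.linear smul smul \<Phi> \<and>
     (\<forall>x. \<exists>\<theta>. lie_automorphism smul bracket \<theta> \<and> \<Phi> x = \<theta> x)"

definition two_local_lie_automorphism ::
  "('f::field \<Rightarrow> 'l::ab_group_add \<Rightarrow> 'l) \<Rightarrow> ('l \<Rightarrow> 'l \<Rightarrow> 'l) \<Rightarrow> ('l \<Rightarrow> 'l) \<Rightarrow> bool" where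
  "two_local_lie_automorphism smul bracket \<Phi> \<longleftrightarrow>
     (\<forall>x y. \<exists>\<theta>. lie_automorphism smul bracket \<theta> \<and> \<Phi> x = \<theta> x \<and> \<Phi> y = \<theta> y)"


section \<open>Laurent polynomials\<close>

text \<open>The Laurent polynomial algebra in the variables \<open>t\<^sub>i\<close>, \<open>i :: 'n\<close>, is the group algebra of the
  exponent lattice \<open>int ^ 'n\<close>: \<open>Poly_Mapping.single a c\<close> is the term
  \<open>c t\<^sup>a\<close>, and multiplication is the convolution product of \<^theory>\<open>HOL-Library.Poly_Mapping\<close>.
  The index type \<open>'n\<close> is finite and nonempty, so \<open>n = CARD('n) \<ge> 1\<close>.\<close>

type_synonym ('f, 'n) laurent = "(int ^ 'n) \<Rightarrow>\<^sub>0 'f"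

definition laurent_scale :: "'f::field \<Rightarrow> ('f, 'n::finite) laurent \<Rightarrow> ('f, 'n) laurent" where
  "laurent_scale c p = Poly_Mapping.single 0 c * p"

lemma lookup_laurent_scale:
  "Poly_Mapping.lookup (laurent_scale c p) a = c * Poly_Mapping.lookup p a"
proof -
  have "laurent_scale c p = Poly_Mapping.map ((*) c) p"
    unfolding laurent_scale_def by (rule mult_map_scale_conv_mult[symmetric])
  then show ?thesis
    by (simp add: Poly_Mapping.map.rep_eq when_def)
qed

lemma laurent_scale_mult_left: "laurent_scale c (p * q) = laurent_scale c p * q"
  by (simp add: laurent_scale_def mult.assoc)

lemma laurent_scale_mult_right: "laurent_scale c (p * q) = p * laurent_scale c q"
  by (simp add: laurent_scale_def mult.left_commute)

lemma vector_space_laurent: "vector_space laurent_scale"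
  by unfold_locales
    (simp_all add: poly_mapping_eq_iff fun_eq_iff lookup_laurent_scale
      Poly_Mapping.lookup_add algebra_simps)


section \<open>The Witt algebra\<close>

definition derivation :: "(('f::field, 'n::finite) laurent \<Rightarrow> ('f, 'n) laurent) \<Rightarrow> bool" where
  "derivation D \<longleftrightarrow>
     Vector_Spaces.linear laurent_scale laurent_scale D \<and>
     (\<forall>p q. D (p * q) = D p * q + p * D q)"

lemma derivation_iff:
  "derivation D \<longleftrightarrow>
     (\<forall>p q. D (p + q) = D p + D q) \<and> (\<forall>c p. D (laurent_scale c p) = laurent_scale c (D p)) \<and>
     (\<forall>p q. D (p * q) = D p * q + p * D q)"
  by (auto simp: derivation_def Vector_Spaces.linear_iff vector_space_laurent)

lemma laurent_scale_simps:
  "laurent_scale c (p + q) = laurent_scale c p + laurent_scale c q"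
  "laurent_scale c (p - q) = laurent_scale c p - laurent_scale c q"
  "laurent_scale c (- p) = - laurent_scale c p"
  "laurent_scale c 0 = 0"
  "laurent_scale (c + d) p = laurent_scale c p + laurent_scale d p"
  "laurent_scale c (laurent_scale d p) = laurent_scale (c * d) p"
  "laurent_scale 1 p = p"
  by (simp_all add: poly_mapping_eq_iff fun_eq_iff lookup_laurent_scale
      Poly_Mapping.lookup_add Poly_Mapping.lookup_minus Poly_Mapping.lookup_uminus algebra_simps)

lemma derivation_zero: "derivation (\<lambda>_. 0)"
  by (simp add: derivation_iff laurent_scale_simps)

typedef (overloaded) ('f::field, 'n::finite) witt =
  "{D :: ('f, 'n) laurent \<Rightarrow> ('f, 'n) laurent. derivation D}"
  morphisms apply_witt Abs_witt
  using derivation_zero by blast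

setup_lifting type_definition_witt

instantiation witt :: (field, finite) ab_group_add
begin

lift_definition zero_witt :: "('a, 'b) witt" is "\<lambda>_. 0"
  by (rule derivation_zero)

lift_definition plus_witt :: "('a, 'b) witt \<Rightarrow> ('a, 'b) witt \<Rightarrow> ('a, 'b) witt"
  is "\<lambda>D E p. D p + E p"
  by (simp add: derivation_iff laurent_scale_simps algebra_simps)

lift_definition minus_witt :: "('a, 'b) witt \<Rightarrow> ('a, 'b) witt \<Rightarrow> ('a, 'b) witt"
  is "\<lambda>D E p. D p - E p"
  by (simp add: derivation_iff laurent_scale_simps algebra_simps)

lift_definition uminus_witt :: "('a, 'b) witt \<Rightarrow> ('a, 'b) witt"
  is "\<lambda>D p. - D p"
  by (simp add: derivation_iff laurent_scale_simps algebra_simps)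

instance
  by standard (transfer, simp add: fun_eq_iff algebra_simps)+

end

lift_definition witt_scale :: "'f::field \<Rightarrow> ('f, 'n::finite) witt \<Rightarrow> ('f, 'n) witt"
  is "\<lambda>c D p. laurent_scale c (D p)"
  by (simp add: derivation_iff laurent_scale_simps laurent_scale_mult_left[symmetric]
      laurent_scale_mult_right[symmetric] mult.commute[of c for c :: 'f])

lift_definition witt_bracket :: "('f::field, 'n::finite) witt \<Rightarrow> ('f, 'n) witt \<Rightarrow> ('f, 'n) witt"
  is "\<lambda>D E p. D (E p) - E (D p)"
  by (simp add: derivation_iff laurent_scale_simps algebra_simps)

lemma derivation_diff: "derivation D \<Longrightarrow> D (p - q) = D p - D q"
  by (metis derivation_iff add_diff_cancel diff_add_cancel)

lemma vector_space_witt: "vector_space witt_scale"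
  by unfold_locales (transfer, simp add: fun_eq_iff laurent_scale_simps)+

lemma lie_algebra_witt:
  "lie_algebra (witt_scale :: 'f::field \<Rightarrow> ('f, 'n::finite) witt \<Rightarrow> _) witt_bracket"
proof (intro lie_algebra.intro vector_space_witt lie_algebra_axioms.intro)
  fix x y z :: "('f, 'n) witt"
  show "Vector_Spaces.linear witt_scale witt_scale (\<lambda>x. witt_bracket x y)"
    unfolding Vector_Spaces.linear_iff
    by (intro conjI allI vector_space_witt; transfer)
      (simp_all add: fun_eq_iff derivation_iff laurent_scale_simps algebra_simps)
  show "Vector_Spaces.linear witt_scale witt_scale (witt_bracket x)"
    unfolding Vector_Spaces.linear_iff
    by (intro conjI allI vector_space_witt; transfer)
      (simp_all add: fun_eq_iff derivation_iff laurent_scale_simps algebra_simps)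
  show "witt_bracket x x = 0"
    by transfer simp
  show "witt_bracket x (witt_bracket y z) + witt_bracket y (witt_bracket z x)
      + witt_bracket z (witt_bracket x y) = 0"
    by transfer (simp add: fun_eq_iff derivation_diff)
qed

end

theory Submission
  imports Defs "HOL-Analysis.Determinants"
begin

text \<open>
  Write an element of the Witt algebra as a finite sum of homogeneous derivations
  \<open>t\<^sup>a u\<close> (here \<open>wterm a u\<close>), with \<open>a\<close> in the exponent lattice and \<open>u\<close> a vector over the field, so that
  \<open>[t\<^sup>a u, t\<^sup>b v] = t\<^bsup>a+b\<^esup> (\<langle>u, b\<rangle> v - \<langle>v, a\<rangle> u)\<close>. The proof rests on the classification of
  automorphisms in \<open>automorphism_graded_form\<close>: each has the shape \<open>t\<^sup>a u \<mapsto> \<kappa>(a) t\<^bsup>\<tau>(a)\<^esup> A(u)\<close>, where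
  \<open>\<tau>\<close> is an automorphism of the lattice, \<open>A\<close> is given by its inverse transpose and \<open>\<kappa>\<close> is a multiplicative
  character.

  The classification goes as follows. The elements of degree zero are exactly those \<open>x\<close> for which \<open>ad x\<close>
  is diagonalizable, because a component of extreme nonzero degree makes the iterates of \<open>ad x\<close> spread over
  infinitely many degrees (\<open>ad_diagonalizable_imp_degree_zero\<close>). So an automorphism preserves degree zero and
  permutes the simultaneous eigenspaces of the degree-zero part, that is, the homogeneous components. It acts
  on each component by a linear map, which has to be shown proportional to \<open>A\<close>. The trace of
  \<open>ad (t\<^bsup>-a\<^esup> u) ad (t\<^sup>a u)\<close> on the component of degree \<open>b\<close> is invariant and has \<open>n \<langle>u, b\<rangle>\<^sup>2\<close> as its
  quadratic part in \<open>b\<close>; comparing these quadratic forms and using that the square of a linear form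
  factors in one way only gives the proportionality (\<open>automorphism_square_identity\<close>).

  Such maps are very rigid (\<open>graded_form_rigid\<close>): on a test element \<open>\<Sum>s\<in>S. t\<^sup>s h\<close>, where \<open>S\<close> is a finite set
  of degrees containing \<open>0\<close> and \<open>h\<close> pairs to distinct values with them, the image already determines
  \<open>\<tau>\<close> and \<open>\<kappa>\<close> on \<open>S\<close>. For \<open>S\<close> made of \<open>0\<close> and the axis vectors, an automorphism is determined by
  this one value; in a 2-local automorphism, all automorphisms chosen for pairs containing the test element
  therefore coincide. For a local automorphism, elements \<open>h + t\<^sup>a u\<close> with arbitrary \<open>h\<close> of degree zero
  show that it has the shape above with some scalars \<open>\<kappa>\<close>, and the test element for
  \<open>S = {0, a, b, a + b}\<close> shows that they are multiplicative.
\<close>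

section \<open>The pairing between coefficient vectors and exponents\<close>

definition pairing :: "'f::comm_ring_1 ^ 'n::finite \<Rightarrow> int ^ 'n \<Rightarrow> 'f" where
  "pairing u a = (\<Sum>i\<in>UNIV. u $ i * of_int (a $ i))"

lemma pairing_simps [simp]:
  "pairing 0 a = 0" "pairing u 0 = 0"
  "pairing (u + v) a = pairing u a + pairing v a"
  "pairing (u - v) a = pairing u a - pairing v a"
  "pairing (- u) a = - pairing u a"
  "pairing (c *s u) a = c * pairing u a"
  "pairing u (a + b) = pairing u a + pairing u b"
  "pairing u (a - b) = pairing u a - pairing u b"
  "pairing u (- a) = - pairing u a"
  by (simp_all add: pairing_def sum.distrib sum_subtractf sum_negf sum_distrib_left algebra_simps)

lemma pairing_axis_left [simp]: "pairing (axis i c) a = c * of_int (a $ i)"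
proof -
  have "pairing (axis i c) a = (\<Sum>k\<in>UNIV. if k = i then c * of_int (a $ i) else 0)"
    unfolding pairing_def axis_def by (intro sum.cong) auto
  then show ?thesis by simp
qed

lemma pairing_axis_right [simp]: "pairing u (axis i m) = u $ i * of_int m"
proof -
  have "pairing u (axis i m) = (\<Sum>k\<in>UNIV. if k = i then u $ i * of_int m else 0)"
    unfolding pairing_def axis_def by (intro sum.cong) auto
  then show ?thesis by simp
qed

lemma pairing_eq_0_imp_left:
  assumes "\<And>a. pairing u a = 0"
  shows "u = 0"
  using assms[of "axis _ 1"] by (simp add: vec_eq_iff)

lemma pairing_cancel_left:
  assumes "\<And>a. pairing u a = pairing v a"
  shows "u = v"
  using pairing_eq_0_imp_left[of "u - v"] assms by simp

lemma pairing_cancel_right: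
  fixes a b :: "int ^ 'n::finite"
  assumes "\<And>u :: 'f::{comm_ring_1, ring_char_0} ^ 'n. pairing u a = pairing u b"
  shows "a = b"
  using assms[of "axis _ 1"] by (simp add: vec_eq_iff)

lemma exponent_induct [case_names axis add uminus]:
  fixes P :: "int ^ 'n::finite \<Rightarrow> bool"
  assumes axis: "\<And>i. P (axis i 1)"
    and add: "\<And>a b. P a \<Longrightarrow> P b \<Longrightarrow> P (a + b)"
    and uminus: "\<And>a. P a \<Longrightarrow> P (- a)"
  shows "P a"
proof -
  have zero: "P 0"
    using add[OF axis uminus[OF axis], of undefined undefined] by simp
  have nat_case: "P (int k *s axis i 1)" for k i
  proof (induction k)
    case 0
    show ?case by (simp add: zero)
  next
    case (Suc k)
    then show ?case using add[OF axis[of i]] by (simp add: vector_sadd_rdistrib)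
  qed
  have multiple: "P (m *s axis i 1)" for m i
  proof (cases m)
    case (nonneg k)
    then show ?thesis using nat_case by simp
  next
    case (neg k)
    have "P (- (int (Suc k) *s axis i 1))" by (rule uminus[OF nat_case])
    moreover have "m *s axis i 1 = - (int (Suc k) *s (axis i 1 :: int ^ 'n))"
      by (simp add: neg vec_eq_iff algebra_simps)
    ultimately show ?thesis by simp
  qed
  have "P (\<Sum>i\<in>I. (a $ i) *s axis i 1)" if "finite I" for I :: "'n set"
    using that by induction (auto intro: zero add multiple)
  from this[of UNIV] show ?thesis
    by (simp add: basis_expansion)
qed

lemma additive_on_exponents_eq_pairing:
  fixes f :: "int ^ 'n::finite \<Rightarrow> 'f::comm_ring_1"
  assumes add: "\<And>a b. f (a + b) = f a + f b"
  shows "f a = pairing (\<chi> i. f (axis i 1)) a"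
proof (induction a rule: exponent_induct)
  case (uminus a)
  have "f 0 = 0" using add[of 0 0] by simp
  then have "f (- a) = - f a" using add[of a "- a"] by (simp add: eq_neg_iff_add_eq_0 add.commute)
  then show ?case using uminus by simp
qed (simp_all add: add)

text \<open>Finitely many hyperplanes do not cover the lattice. When \<open>d\<close> is added to the set, the vector
  \<open>h\<close> found so far is moved along the line \<open>h + k d\<close>; each member of the set excludes at most one
  integer \<open>k\<close>, because \<open>pairing d d\<close> is a positive sum of squares.\<close>

lemma ex_separating_integer_vector:
  assumes "finite (S :: (int ^ 'n::finite) set)"
  shows "\<exists>h :: int ^ 'n. \<forall>d\<in>S - {0}. pairing h d \<noteq> 0"
  using assms
proof induction
  case (insert d S)
  then obtain h :: "int ^ 'n" where h: "\<And>s. s \<in> S - {0} \<Longrightarrow> pairing h s \<noteq> 0" by auto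
  show ?case
  proof (cases "d = 0")
    case False
    have "pairing d d = (\<Sum>i\<in>UNIV. (d $ i)\<^sup>2)" by (simp add: pairing_def power2_eq_square)
    then have dd: "pairing d d \<noteq> 0"
      using False by (auto simp: sum_nonneg_eq_0_iff vec_eq_iff)
    define bad where "bad s = {k. pairing (h + k *s d) s = 0}" for s
    have "finite (bad s)" if "s \<in> insert d S - {0}" for s
    proof (cases "pairing d s = 0")
      case True
      then have "bad s = {}" using h[of s] that dd by (auto simp: bad_def)
      then show ?thesis by simp
    next
      case nz: False
      have "k = l" if "k \<in> bad s" "l \<in> bad s" for k l
      proof -
        have "pairing h s + k * pairing d s = 0" "pairing h s + l * pairing d s = 0"
          using that by (simp_all add: bad_def)
        then have "k * pairing d s = l * pairing d s" by linarith
        then show ?thesis using nz by simp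
      qed
      then have "bad s \<subseteq> {k}" if "k \<in> bad s" for k using that by blast
      then show ?thesis by (metis finite.emptyI finite.insertI finite_subset subset_emptyI)
    qed
    then have "finite (\<Union>s\<in>insert d S - {0}. bad s)" using insert.hyps(1) by blast
    then obtain k where "k \<notin> (\<Union>s\<in>insert d S - {0}. bad s)"
      using ex_new_if_finite[OF infinite_UNIV_int] by blast
    then have "\<forall>s\<in>insert d S - {0}. pairing (h + k *s d) s \<noteq> 0" by (auto simp: bad_def)
    then show ?thesis by blast
  qed (use h in auto)
qed auto

text \<open>Requiring \<open>h \<noteq> 0\<close> allows the same vector to serve as a coefficient of the test elements below;
  injectivity alone would admit \<open>h = 0\<close> on a singleton.\<close>

definition separates :: "'f::comm_ring_1 ^ 'n::finite \<Rightarrow> (int ^ 'n) set \<Rightarrow> bool" where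
  "separates h S \<longleftrightarrow> h \<noteq> 0 \<and> inj_on (pairing h) S"

text \<open>Over the field of rationals no vector is injective on the whole lattice once \<open>n \<ge> 2\<close>, so
  separation is available for finite sets only. A vector with integer entries is good enough for every
  ring of characteristic zero.\<close>

lemma ex_separates:
  assumes "finite (S :: (int ^ 'n::finite) set)"
  shows "\<exists>h :: 'f::{comm_ring_1, ring_char_0} ^ 'n. separates h S"
proof -
  \<comment> \<open>The extra axis vector forces the separating vector to be nonzero.\<close>
  define T where "T = insert (axis undefined 1) ((\<lambda>(a, b). a - b) ` (S \<times> S))"
  have "finite T" using assms by (simp add: T_def)
  then obtain h :: "int ^ 'n" where h: "\<And>d. d \<in> T - {0} \<Longrightarrow> pairing h d \<noteq> 0"
    using ex_separating_integer_vector by blast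
  define g :: "'f ^ 'n" where "g = (\<chi> i. of_int (h $ i))"
  have g: "pairing g a = of_int (pairing h a)" for a by (simp add: g_def pairing_def)
  have "pairing h (axis undefined 1) \<noteq> 0" by (rule h) (simp add: T_def)
  then have "h \<noteq> 0" by auto
  then have "g \<noteq> 0" by (auto simp: g_def vec_eq_iff)
  moreover have "inj_on (pairing g) S"
  proof (rule inj_onI, rule ccontr)
    fix a b assume "a \<in> S" "b \<in> S" "pairing g a = pairing g b" "a \<noteq> b"
    moreover from this have "a - b \<in> T - {0}" by (auto simp: T_def)
    ultimately show False using h[of "a - b"] by (simp add: g)
  qed
  ultimately show ?thesis by (auto simp: separates_def)
qed

section \<open>Homogeneous derivations\<close>

lemma laurent_induct [case_names single add]:
  fixes P :: "('f::field, 'n::finite) laurent \<Rightarrow> bool"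
  assumes single: "\<And>a c. P (Poly_Mapping.single a c)"
    and add: "\<And>p q. P p \<Longrightarrow> P q \<Longrightarrow> P (p + q)"
  shows "P p"
proof (induction p rule: update_induct)
  case const
  show ?case using single[of 0 0] by simp
next
  case (update p a c)
  have "Poly_Mapping.update a c p = p + Poly_Mapping.single a c"
    using update.hyps by (intro poly_mapping_eqI)
      (auto simp: lookup_update lookup_add lookup_single when_def in_keys_iff)
  then show ?case using add[OF update.IH single] by simp
qed

text \<open>The derivation \<open>\<Sum>i. u\<^sub>i t\<^sub>i \<partial>/\<partial>t\<^sub>i\<close>, which multiplies \<open>t\<^sup>a\<close> by \<open>pairing u a\<close>.\<close>

definition euler :: "'f::field ^ 'n::finite \<Rightarrow> ('f, 'n) laurent \<Rightarrow> ('f, 'n) laurent" where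
  "euler u p = Abs_poly_mapping (\<lambda>a. pairing u a * Poly_Mapping.lookup p a)"

lemma lookup_euler: "Poly_Mapping.lookup (euler u p) a = pairing u a * Poly_Mapping.lookup p a"
proof -
  have "finite {a. pairing u a * Poly_Mapping.lookup p a \<noteq> 0}"
    by (rule finite_subset[OF _ finite_lookup[of p]]) auto
  then show ?thesis by (simp add: euler_def)
qed

lemma euler_add: "euler u (p + q) = euler u p + euler u q"
  by (rule poly_mapping_eqI) (simp add: lookup_euler lookup_add algebra_simps)

lemma euler_single:
  "euler u (Poly_Mapping.single a c) = Poly_Mapping.single a (pairing u a * c)"
  by (rule poly_mapping_eqI) (simp add: lookup_euler lookup_single when_def)

lemma euler_mult: "euler u (p * q) = euler u p * q + p * euler u q"
proof (induction p rule: laurent_induct)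
  case (single a c)
  show ?case
    by (induction q rule: laurent_induct)
      (simp_all add: mult_single euler_single euler_add algebra_simps flip: single_add)
qed (simp add: euler_add algebra_simps)

lemma euler_scale: "euler u (laurent_scale c p) = laurent_scale c (euler u p)"
  by (rule poly_mapping_eqI) (simp add: lookup_euler lookup_laurent_scale)

text \<open>The homogeneous derivation \<open>t\<^sup>a \<Sum>i. u\<^sub>i t\<^sub>i \<partial>/\<partial>t\<^sub>i\<close> of degree \<open>a\<close>.\<close>

lift_definition wterm :: "int ^ 'n::finite \<Rightarrow> 'f::field ^ 'n \<Rightarrow> ('f, 'n) witt"
  is "\<lambda>a u p. Poly_Mapping.single a 1 * euler u p"
  by (simp add: derivation_iff euler_add euler_mult euler_scale laurent_scale_mult_right
      distrib_left mult.assoc mult.left_commute)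

lemma apply_wterm_single:
  "apply_witt (wterm a u) (Poly_Mapping.single b c) = Poly_Mapping.single (a + b) (pairing u b * c)"
  by (simp add: wterm.rep_eq euler_single mult_single)

lemma derivation_apply_witt: "derivation (apply_witt x)"
  using apply_witt by auto

lemmas apply_witt_add = derivation_apply_witt[unfolded derivation_iff, THEN conjunct1, rule_format]
lemmas apply_witt_scale =
  derivation_apply_witt[unfolded derivation_iff, THEN conjunct2, THEN conjunct1, rule_format]
lemmas apply_witt_mult =
  derivation_apply_witt[unfolded derivation_iff, THEN conjunct2, THEN conjunct2, rule_format]

lemma laurent_scale_single:
  "laurent_scale c (Poly_Mapping.single a d) = Poly_Mapping.single a (c * d)"
  by (rule poly_mapping_eqI) (simp add: lookup_laurent_scale lookup_single when_def)

lemma witt_eqI: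
  assumes "\<And>b. apply_witt x (Poly_Mapping.single b 1) = apply_witt y (Poly_Mapping.single b 1)"
  shows "x = y"
proof -
  have "apply_witt x p = apply_witt y p" for p
  proof (induction p rule: laurent_induct)
    case (single a c)
    have "Poly_Mapping.single a c = laurent_scale c (Poly_Mapping.single a 1)"
      by (simp add: laurent_scale_single)
    then show ?case by (simp add: apply_witt_scale assms)
  qed (simp add: apply_witt_add)
  then show ?thesis by (simp add: apply_witt_inject[symmetric] fun_eq_iff)
qed

text \<open>The coordinates of \<open>x\<close> in degree \<open>a\<close>, read off from \<open>x(t\<^sub>i)\<close>: the degree-\<open>a\<close> part of a
  derivation sends \<open>t\<^sub>i\<close> to a multiple of \<open>t\<^sup>a t\<^sub>i\<close>, which explains the shift by \<open>axis i 1\<close>.\<close>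

definition wcoeff :: "('f::field, 'n::finite) witt \<Rightarrow> int ^ 'n \<Rightarrow> 'f ^ 'n" where
  "wcoeff x a = (\<chi> i. Poly_Mapping.lookup (apply_witt x (Poly_Mapping.single (axis i 1) 1)) (a + axis i 1))"

lemma lookup_single_mult_shift:
  fixes p :: "('f::field, 'n::finite) laurent"
  shows "Poly_Mapping.lookup (Poly_Mapping.single a 1 * p) (a + b) = Poly_Mapping.lookup p b"
  by (induction p rule: laurent_induct)
    (simp_all add: mult_single lookup_single when_def lookup_add algebra_simps)

text \<open>By the product rule, the coefficient of \<open>t\<^sup>a t\<^sup>b\<close> in \<open>x(t\<^sup>b)\<close> is additive in \<open>b\<close>, and an additive
  function on the exponent lattice is the pairing with its values on the axes. This is why the values on
  the variables, that is \<open>wcoeff\<close>, determine a derivation.\<close>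

lemma lookup_apply_witt:
  "Poly_Mapping.lookup (apply_witt x (Poly_Mapping.single b 1)) (a + b) = pairing (wcoeff x a) b"
proof -
  define f where "f b = Poly_Mapping.lookup (apply_witt x (Poly_Mapping.single b 1)) (a + b)" for b
  have "f (b + c) = f b + f c" for b c
  proof -
    have "apply_witt x (Poly_Mapping.single (b + c) 1) =
        Poly_Mapping.single c 1 * apply_witt x (Poly_Mapping.single b 1)
        + Poly_Mapping.single b 1 * apply_witt x (Poly_Mapping.single c 1)"
      using apply_witt_mult[of x "Poly_Mapping.single b 1" "Poly_Mapping.single c 1"]
      by (simp add: mult_single mult.commute)
    moreover have "a + (b + c) = c + (a + b)" "a + (b + c) = b + (a + c)"
      by (simp_all add: algebra_simps)
    ultimately show ?thesis
      unfolding f_def by (metis lookup_add lookup_single_mult_shift)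
  qed
  then have "f b = pairing (\<chi> i. f (axis i 1)) b" by (rule additive_on_exponents_eq_pairing)
  then show ?thesis by (simp add: f_def wcoeff_def)
qed

lemma witt_eq_iff_wcoeff: "x = y \<longleftrightarrow> (\<forall>a. wcoeff x a = wcoeff y a)"
proof
  assume eq: "\<forall>a. wcoeff x a = wcoeff y a"
  show "x = y"
  proof (rule witt_eqI, rule poly_mapping_eqI)
    fix b c :: "int ^ 'b"
    have "c = (c - b) + b" by simp
    then show "Poly_Mapping.lookup (apply_witt x (Poly_Mapping.single b 1)) c =
        Poly_Mapping.lookup (apply_witt y (Poly_Mapping.single b 1)) c"
      using eq by (metis lookup_apply_witt)
  qed
qed simp

lemma wcoeff_wterm: "wcoeff (wterm a u) b = (if b = a then u else 0)"
proof -
  have "wcoeff (wterm a u) b $ i = (if b = a then u else 0) $ i" for i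
    by (simp add: wcoeff_def apply_wterm_single lookup_single when_def)
  then show ?thesis by (simp only: vec_eq_iff) simp
qed

lemma wcoeff_simps [simp]:
  "wcoeff 0 a = 0"
  "wcoeff (x + y) a = wcoeff x a + wcoeff y a"
  "wcoeff (witt_scale c x) a = c *s wcoeff x a"
  by (simp_all add: wcoeff_def vec_eq_iff zero_witt.rep_eq plus_witt.rep_eq witt_scale.rep_eq
      lookup_add lookup_laurent_scale)

lemma wcoeff_sum: "wcoeff (sum f I) a = (\<Sum>i\<in>I. wcoeff (f i) a)"
  by (induction I rule: infinite_finite_induct) simp_all

lemma wterm_simps [simp]:
  "wterm a 0 = 0"
  "wterm a u + wterm a v = wterm a (u + v)"
  "witt_scale c (wterm a u) = wterm a (c *s u)"
  by (simp_all add: witt_eq_iff_wcoeff wcoeff_wterm)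

lemma wterm_inject: "wterm a u = wterm a v \<longleftrightarrow> u = v"
  by (metis wcoeff_wterm)

definition wsupp :: "('f::field, 'n::finite) witt \<Rightarrow> (int ^ 'n) set" where
  "wsupp x = {a. wcoeff x a \<noteq> 0}"

lemma finite_wsupp: "finite (wsupp x)"
proof -
  have "wsupp x \<subseteq> (\<Union>i. (\<lambda>b. b - axis i 1) `
      Poly_Mapping.keys (apply_witt x (Poly_Mapping.single (axis i 1) 1)))"
  proof
    fix a assume "a \<in> wsupp x"
    then obtain i where "wcoeff x a $ i \<noteq> 0" by (auto simp: wsupp_def vec_eq_iff)
    then have "a + axis i 1 \<in> Poly_Mapping.keys (apply_witt x (Poly_Mapping.single (axis i 1) 1))"
      by (simp add: wcoeff_def in_keys_iff)
    then show "a \<in> (\<Union>i. (\<lambda>b. b - axis i 1) `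
        Poly_Mapping.keys (apply_witt x (Poly_Mapping.single (axis i 1) 1)))"
      by (metis (no_types, lifting) UN_I UNIV_I add_diff_cancel_right' image_eqI)
  qed
  then show ?thesis by (rule finite_subset) simp
qed

text \<open>Together with \<open>witt_eq_iff_wcoeff\<close> and \<open>finite_wsupp\<close> this identifies the Witt algebra
  with finitely supported families of vectors indexed by the lattice.\<close>

lemma witt_eq_sum_wterm:
  assumes "finite S" "wsupp x \<subseteq> S"
  shows "x = (\<Sum>a\<in>S. wterm a (wcoeff x a))"
  using assms by (auto simp: witt_eq_iff_wcoeff wcoeff_sum wcoeff_wterm wsupp_def)

lemma witt_induct [case_names zero wterm add]:
  assumes zero: "P 0" and wterm: "\<And>a u. P (wterm a u)"
    and add: "\<And>x y. P x \<Longrightarrow> P y \<Longrightarrow> P (x + y)"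
  shows "P x"
proof -
  have "P (\<Sum>a\<in>S. wterm a (wcoeff x a))" if "finite S" for S
    using that by induction (auto intro: assms)
  then show ?thesis using witt_eq_sum_wterm[OF finite_wsupp order.refl, of x] finite_wsupp by metis
qed

section \<open>The Lie bracket in homogeneous coordinates\<close>

lemma linear_witt_iff:
  "Vector_Spaces.linear witt_scale witt_scale \<theta> \<longleftrightarrow>
    (\<forall>x y. \<theta> (x + y) = \<theta> x + \<theta> y) \<and> (\<forall>c x. \<theta> (witt_scale c x) = witt_scale c (\<theta> x))"
  by (simp add: Vector_Spaces.linear_iff vector_space_witt)

lemma witt_bracket_add [simp]:
  "witt_bracket (x + y) z = witt_bracket x z + witt_bracket y z"
  "witt_bracket z (x + y) = witt_bracket z x + witt_bracket z y"
  "witt_bracket 0 z = 0" "witt_bracket z 0 = 0"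
  using lie_algebra.bracket_linear_left[OF lie_algebra_witt, of z]
    lie_algebra.bracket_linear_right[OF lie_algebra_witt, of z]
  by (simp_all add: linear_witt_iff) (metis add_cancel_right_right)+

lemma witt_bracket_sum: "witt_bracket (sum f I) z = (\<Sum>i\<in>I. witt_bracket (f i) z)"
  and witt_bracket_sum_right: "witt_bracket z (sum f I) = (\<Sum>i\<in>I. witt_bracket z (f i))"
  by (induction I rule: infinite_finite_induct) simp_all

lemma witt_bracket_scale [simp]:
  "witt_bracket (witt_scale c x) z = witt_scale c (witt_bracket x z)"
  "witt_bracket z (witt_scale c x) = witt_scale c (witt_bracket z x)"
  using lie_algebra.bracket_linear_left[OF lie_algebra_witt, of z]
    lie_algebra.bracket_linear_right[OF lie_algebra_witt, of z]
  by (simp_all add: linear_witt_iff)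

lemma witt_bracket_wterm:
  "witt_bracket (wterm a u) (wterm b v) = wterm (a + b) (pairing u b *s v - pairing v a *s u)"
  by (rule witt_eqI)
    (simp add: witt_bracket.rep_eq apply_wterm_single algebra_simps flip: single_diff)

lemma wcoeff_bracket_wterm:
  "wcoeff (witt_bracket (wterm a u) y) (a + b) =
    pairing u b *s wcoeff y b - pairing (wcoeff y b) a *s u"
  by (induction y rule: witt_induct)
    (auto simp: witt_bracket_wterm wcoeff_wterm vec.scale_left_distrib vec.scale_right_distrib)

lemma wcoeff_bracket:
  assumes "finite S" "wsupp x \<subseteq> S"
  shows "wcoeff (witt_bracket x y) c =
    (\<Sum>a\<in>S. pairing (wcoeff x a) (c - a) *s wcoeff y (c - a)
      - pairing (wcoeff y (c - a)) a *s wcoeff x a)"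
proof -
  have "wcoeff (witt_bracket x y) c = (\<Sum>a\<in>S. wcoeff (witt_bracket (wterm a (wcoeff x a)) y) c)"
    by (subst witt_eq_sum_wterm[OF assms]) (simp add: witt_bracket_sum wcoeff_sum)
  also have "\<dots> = (\<Sum>a\<in>S. pairing (wcoeff x a) (c - a) *s wcoeff y (c - a)
      - pairing (wcoeff y (c - a)) a *s wcoeff x a)"
  proof (rule sum.cong[OF refl])
    fix a
    have "a + (c - a) = c" by simp
    then show "wcoeff (witt_bracket (wterm a (wcoeff x a)) y) c =
        pairing (wcoeff x a) (c - a) *s wcoeff y (c - a)
        - pairing (wcoeff y (c - a)) a *s wcoeff x a"
      using wcoeff_bracket_wterm[of a "wcoeff x a" y "c - a"] by metis
  qed
  finally show ?thesis .
qed

section \<open>Diagonalizable elements have degree zero\<close>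

text \<open>Diagonalizability of \<open>ad x\<close> without reference to bases or eigenspaces: an automorphism transports the
  property by mapping each set \<open>Y\<close> of eigenvectors to its image, and iterates of \<open>ad x\<close> can be read off from
  the sum.\<close>

definition ad_diagonalizable :: "('f::field, 'n::finite) witt \<Rightarrow> bool" where
  "ad_diagonalizable x \<longleftrightarrow>
    (\<forall>y. \<exists>Y. finite Y \<and> (\<forall>v\<in>Y. \<exists>c. witt_bracket x v = witt_scale c v) \<and> y = \<Sum>Y)"

lemma ad_diagonalizable_degree_zero: "ad_diagonalizable (wterm 0 h)"
  unfolding ad_diagonalizable_def
proof
  fix y :: "('a, 'b) witt"
  define t where "t a = wterm a (wcoeff y a)" for a
  have "inj_on t (wsupp y)"
    by (rule inj_onI) (metis (mono_tags, lifting) wsupp_def mem_Collect_eq t_def wcoeff_wterm)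
  moreover have "y = (\<Sum>a\<in>wsupp y. t a)"
    unfolding t_def by (rule witt_eq_sum_wterm[OF finite_wsupp order.refl])
  ultimately have "y = \<Sum>(t ` wsupp y)" by (simp add: sum.reindex)
  moreover have "witt_bracket (wterm 0 h) (t a) = witt_scale (pairing h a) (t a)" for a
    by (simp add: t_def witt_bracket_wterm)
  ultimately show "\<exists>Y. finite Y \<and> (\<forall>v\<in>Y. \<exists>c. witt_bracket (wterm 0 h) v = witt_scale c v) \<and> y = \<Sum>Y"
    using finite_wsupp[of y] by (intro exI[of _ "t ` wsupp y"]) auto
qed

text \<open>Grading by a linear functional \<open>l\<close>, the highest component of a bracket is the bracket of the highest
  components. For \<open>x\<close> the top degree \<open>a0\<close> must be the only one of its level, so that no other summand
  reaches degree \<open>a0 + b0\<close>.\<close>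

lemma top_coeff_bracket:
  fixes l :: "int ^ 'n::finite" and x y :: "('f::field, 'n) witt"
  assumes x: "\<And>a. a \<in> wsupp x \<Longrightarrow> a \<noteq> a0 \<Longrightarrow> pairing l a < pairing l a0"
    and y: "\<And>b. b \<in> wsupp y \<Longrightarrow> pairing l b \<le> pairing l b0"
  shows "wcoeff (witt_bracket x y) (a0 + b0) =
      pairing (wcoeff x a0) b0 *s wcoeff y b0 - pairing (wcoeff y b0) a0 *s wcoeff x a0"
    and "\<And>c. c \<in> wsupp (witt_bracket x y) \<Longrightarrow> pairing l c \<le> pairing l (a0 + b0)"
proof -
  have le: "pairing l a \<le> pairing l a0" if "a \<in> wsupp x" for a
    using x[OF that] by (cases "a = a0") auto
  have y0: "wcoeff y b = 0" if "pairing l b > pairing l b0" for b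
    using y[of b] that by (force simp: wsupp_def)
  define g where "g c a = pairing (wcoeff x a) (c - a) *s wcoeff y (c - a)
      - pairing (wcoeff y (c - a)) a *s wcoeff x a" for c a
  have "wcoeff (witt_bracket x y) (a0 + b0) = (\<Sum>a\<in>insert a0 (wsupp x). g (a0 + b0) a)"
    unfolding g_def by (rule wcoeff_bracket) (auto simp: finite_wsupp)
  also have "\<dots> = (\<Sum>a\<in>{a0}. g (a0 + b0) a)"
  proof (rule sum.mono_neutral_right)
    show "\<forall>a\<in>insert a0 (wsupp x) - {a0}. g (a0 + b0) a = 0"
    proof
      fix a assume "a \<in> insert a0 (wsupp x) - {a0}"
      then have "pairing l a < pairing l a0" using x by auto
      then have "wcoeff y (a0 + b0 - a) = 0" by (intro y0) simp
      then show "g (a0 + b0) a = 0" by (simp add: g_def)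
    qed
  qed (auto simp: finite_wsupp)
  finally show "wcoeff (witt_bracket x y) (a0 + b0) =
      pairing (wcoeff x a0) b0 *s wcoeff y b0 - pairing (wcoeff y b0) a0 *s wcoeff x a0"
    by (simp add: g_def del: pairing_simps)
  fix c assume c: "c \<in> wsupp (witt_bracket x y)"
  show "pairing l c \<le> pairing l (a0 + b0)"
  proof (rule ccontr)
    assume gt: "\<not> pairing l c \<le> pairing l (a0 + b0)"
    have "wcoeff (witt_bracket x y) c = (\<Sum>a\<in>wsupp x. g c a)"
      unfolding g_def by (rule wcoeff_bracket) (auto simp: finite_wsupp)
    also have "\<dots> = 0"
    proof (rule sum.neutral, rule)
      fix a assume "a \<in> wsupp x"
      then have "wcoeff y (c - a) = 0" using gt le[of a] by (intro y0) simp
      then show "g c a = 0" by (simp add: g_def)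
    qed
    finally show False using c by (simp add: wsupp_def)
  qed
qed

text \<open>Starting from a vector proportional to the top coefficient \<open>u\<close> of \<open>x\<close> keeps all top coefficients of
  the iterates on the line through \<open>u\<close>. The hypothesis \<open>nz\<close> says that none of the scalar factors
  \<open>pairing u (b + k a0) - pairing u a0\<close> picked up on the way is zero.\<close>

lemma top_coeff_iterated_bracket:
  fixes l :: "int ^ 'n::finite" and x :: "('f::field, 'n) witt"
  assumes x: "\<And>a. a \<in> wsupp x \<Longrightarrow> a \<noteq> a0 \<Longrightarrow> pairing l a < pairing l a0"
    and nz: "\<And>k :: nat. pairing u b + of_nat k * pairing u a0 \<noteq> pairing u a0"
    and u: "u = wcoeff x a0"
  shows "(\<exists>c. c \<noteq> 0 \<and> wcoeff ((witt_bracket x ^^ k) (wterm b u)) (b + int k *s a0) = c *s u) \<and>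
    (\<forall>e\<in>wsupp ((witt_bracket x ^^ k) (wterm b u)). pairing l e \<le> pairing l (b + int k *s a0))"
proof (induction k)
  case 0
  have "wcoeff (wterm b u) b = 1 *s u" by (simp add: wcoeff_wterm)
  then show ?case
    by (auto simp: wsupp_def wcoeff_wterm simp del: pairing_simps split: if_splits intro: exI[of _ 1])
next
  case (Suc k)
  define y where "y = (witt_bracket x ^^ k) (wterm b u)"
  define d where "d = b + int k *s a0"
  obtain c where c: "c \<noteq> 0" "wcoeff y d = c *s u" and y: "\<And>e. e \<in> wsupp y \<Longrightarrow> pairing l e \<le> pairing l d"
    using Suc.IH by (auto simp: y_def d_def)
  have d: "b + int (Suc k) *s a0 = a0 + d" by (simp add: d_def vec_eq_iff algebra_simps)
  have pd: "pairing u d = pairing u b + of_nat k * pairing u a0"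
    by (simp add: d_def pairing_def sum_distrib_left algebra_simps sum.distrib)
  have "wcoeff (witt_bracket x y) (a0 + d) =
      pairing (wcoeff x a0) d *s wcoeff y d - pairing (wcoeff y d) a0 *s wcoeff x a0"
    by (rule top_coeff_bracket(1)[where l = l]) (use x y in auto)
  also have "\<dots> = pairing u d *s (c *s u) - pairing (c *s u) a0 *s u"
    by (simp only: c(2) u[symmetric])
  also have "\<dots> = (c * (pairing u d - pairing u a0)) *s u"
    by (simp add: vec_eq_iff algebra_simps)
  finally have "wcoeff (witt_bracket x y) (a0 + d) = (c * (pairing u d - pairing u a0)) *s u" .
  moreover have "c * (pairing u d - pairing u a0) \<noteq> 0" using nz[of k] c(1) pd by simp
  moreover have "\<forall>e\<in>wsupp (witt_bracket x y). pairing l e \<le> pairing l (a0 + d)"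
    using top_coeff_bracket(2)[OF x y] by blast
  ultimately show ?case unfolding d funpow.simps o_def y_def[symmetric] by blast
qed

text \<open>On a sum of eigenvectors \<open>(ad x)\<^sup>k\<close> only rescales the summands, so no new degrees appear.\<close>

lemma ad_diagonalizable_iterates_supp:
  assumes "ad_diagonalizable x"
  shows "\<exists>T. finite T \<and> (\<forall>k. wsupp ((witt_bracket x ^^ k) y) \<subseteq> T)"
proof -
  obtain Y where Y: "finite Y" "y = \<Sum>Y" and "\<forall>v\<in>Y. \<exists>c. witt_bracket x v = witt_scale c v"
    using assms unfolding ad_diagonalizable_def by blast
  then obtain c where c: "\<And>v. v \<in> Y \<Longrightarrow> witt_bracket x v = witt_scale (c v) v" by metis
  have it: "(witt_bracket x ^^ k) y = (\<Sum>v\<in>Y. witt_scale (c v ^ k) v)" for k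
  proof (induction k)
    case 0
    show ?case using Y(2) by (simp add: vector_space.vector_space_assms(4)[OF vector_space_witt])
  next
    case (Suc k)
    show ?case
      by (simp add: Suc witt_bracket_sum_right, rule sum.cong[OF refl])
        (simp add: c vector_space.vector_space_assms(3)[OF vector_space_witt] mult.commute)
  qed
  have "wsupp ((witt_bracket x ^^ k) y) \<subseteq> (\<Union>v\<in>Y. wsupp v)" for k
  proof
    fix a assume "a \<in> wsupp ((witt_bracket x ^^ k) y)"
    then have "(\<Sum>v\<in>Y. c v ^ k *s wcoeff v a) \<noteq> 0" by (simp add: it wsupp_def wcoeff_sum)
    then obtain v where "v \<in> Y" "c v ^ k *s wcoeff v a \<noteq> 0" by (meson sum.neutral)
    then show "a \<in> (\<Union>v\<in>Y. wsupp v)" by (auto simp: wsupp_def)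
  qed
  moreover have "finite (\<Union>v\<in>Y. wsupp v)" using Y(1) finite_wsupp by blast
  ultimately show ?thesis by blast
qed

text \<open>If \<open>x\<close> had a component of nonzero degree, then after a choice of sign some functional would have a
  unique positive maximum \<open>a0\<close> on the support of \<open>x\<close>, and the iterates \<open>(ad x)\<^sup>k\<close> on a suitable
  homogeneous element would reach the infinitely many degrees \<open>b + k a0\<close>.\<close>

lemma ad_diagonalizable_imp_degree_zero:
  fixes x :: "('f::field_char_0, 'n::finite) witt"
  assumes diag: "ad_diagonalizable x"
  shows "wsupp x \<subseteq> {0}"
proof (rule ccontr)
  assume "\<not> wsupp x \<subseteq> {0}"
  then obtain a1 where a1: "a1 \<in> wsupp x" "a1 \<noteq> 0" by auto
  obtain l' :: "int ^ 'n" where "separates l' (insert 0 (wsupp x))"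
    using ex_separates finite_wsupp by blast
  then have l': "inj_on (pairing l') (insert 0 (wsupp x))" by (simp add: separates_def)
  have l'0: "pairing l' a1 \<noteq> 0" using inj_onD[OF l', of a1 0] a1 by auto
  \<comment> \<open>Flipping the sign if necessary makes the maximum positive, so the degrees \<open>b + k a0\<close> are distinct.\<close>
  define l where "l = (if pairing l' a1 > 0 then l' else - l')"
  have l: "inj_on (pairing l) (wsupp x)" "pairing l a1 > 0"
    using l' l'0 by (auto simp: l_def inj_on_def)
  have "Max (pairing l ` wsupp x) \<in> pairing l ` wsupp x"
    using a1 by (intro Max_in) (auto simp: finite_wsupp)
  then obtain a0 where a0: "a0 \<in> wsupp x" "pairing l a0 = Max (pairing l ` wsupp x)" by auto
  have le: "pairing l a \<le> pairing l a0" if "a \<in> wsupp x" for a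
    using that by (simp add: a0(2) finite_wsupp)
  have lt: "pairing l a < pairing l a0" if "a \<in> wsupp x" "a \<noteq> a0" for a
    using le[OF that(1)] inj_onD[OF l(1) _ that(1) a0(1)] that(2) by force
  have pos: "pairing l a0 > 0" using l(2) le[OF a1(1)] by linarith
  define u where "u = wcoeff x a0"
  have "u \<noteq> 0" using a0(1) by (simp add: u_def wsupp_def)
  have "\<exists>b. \<forall>k::nat. pairing u b + of_nat k * pairing u a0 \<noteq> pairing u a0"
  proof (cases "pairing u a0 = 0")
    case True
    then show ?thesis using pairing_eq_0_imp_left[of u] \<open>u \<noteq> 0\<close> by auto
  next
    case False
    \<comment> \<open>For \<open>b = 2 a0\<close> the factors are \<open>(k + 1) (pairing u a0)\<close>, nonzero in characteristic zero.\<close>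
    have "pairing u (a0 + a0) + of_nat k * pairing u a0 \<noteq> pairing u a0" for k :: nat
    proof
      assume "pairing u (a0 + a0) + of_nat k * pairing u a0 = pairing u a0"
      then have "of_nat (Suc k) * pairing u a0 = 0"
        by (simp only: pairing_simps of_nat_Suc) (simp add: distrib_right add_ac)
      then show False using False by (metis mult_eq_0_iff of_nat_eq_0_iff nat.distinct(1))
    qed
    then show ?thesis by blast
  qed
  then obtain b where b: "\<And>k::nat. pairing u b + of_nat k * pairing u a0 \<noteq> pairing u a0" by blast
  obtain T where T: "finite T" "\<And>k. wsupp ((witt_bracket x ^^ k) (wterm b u)) \<subseteq> T"
    using ad_diagonalizable_iterates_supp[OF diag] by blast
  have "b + int k *s a0 \<in> T" for k
  proof -
    obtain c where "c \<noteq> 0" "wcoeff ((witt_bracket x ^^ k) (wterm b u)) (b + int k *s a0) = c *s u"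
      using top_coeff_iterated_bracket[OF lt b u_def] by blast
    then show ?thesis using T(2)[of k] \<open>u \<noteq> 0\<close> by (auto simp: wsupp_def)
  qed
  then have "range (\<lambda>k. b + int k *s a0) \<subseteq> T" by auto
  moreover have "inj (\<lambda>k. b + int k *s a0)"
  proof (rule injI)
    fix k m assume "b + int k *s a0 = b + int m *s a0"
    then have "int k *s a0 = int m *s a0" by simp
    moreover have "a0 \<noteq> 0" using pos by auto
    ultimately show "k = m" by (auto simp: vec_eq_iff)
  qed
  ultimately show False using T(1) finite_subset range_inj_infinite by blast
qed

section \<open>Linear algebra: traces and proportionality\<close>

lemma linear_vec_iff:
  "Vector_Spaces.linear (*s) (*s) (f :: 'f::field ^ 'n::finite \<Rightarrow> 'f ^ 'n) \<longleftrightarrow>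
    (\<forall>u v. f (u + v) = f u + f v) \<and> (\<forall>c u. f (c *s u) = c *s f u)"
  using vec.vector_space_axioms by (auto simp: Vector_Spaces.linear_iff)

lemma trace_eq_if_conjugate:
  fixes B S T :: "'f::field ^ 'n::finite \<Rightarrow> 'f ^ 'n"
  assumes lin: "Vector_Spaces.linear (*s) (*s) B" "Vector_Spaces.linear (*s) (*s) S"
      "Vector_Spaces.linear (*s) (*s) T"
    and inj: "inj B" and comm: "\<And>v. B (S v) = T (B v)"
  shows "trace (matrix S) = trace (matrix T)"
proof -
  obtain G where G: "Vector_Spaces.linear (*s) (*s) G" "G \<circ> B = id"
    using vec.linear_injective_left_inverse[OF lin(1) inj] by blast
  have surj: "surj B" by (rule vec.linear_inj_imp_surj[OF lin(1) inj])
  have BG: "B \<circ> G = id"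
    using surj G(2) by (metis (no_types, lifting) comp_assoc comp_id fun.map_id surj_fun_eq surj_id id_comp)
  have "S = G \<circ> (T \<circ> B)" using comm G(2) by (auto simp: fun_eq_iff) metis
  then have "trace (matrix S) = trace (matrix G ** (matrix T ** matrix B))"
    using lin G(1) by (simp add: matrix_compose_gen Vector_Spaces.linear_compose)
  also have "\<dots> = trace ((matrix T ** matrix B) ** matrix G)" by (rule trace_mul_sym)
  also have "\<dots> = trace (matrix T ** (matrix B ** matrix G))" by (simp add: matrix_mul_assoc)
  also have "matrix B ** matrix G = matrix (B \<circ> G)"
    using lin G(1) by (simp add: matrix_compose_gen)
  also have "\<dots> = mat 1" by (simp add: BG matrix_id_mat_1 flip: id_def)
  finally show ?thesis by simp
qed

text \<open>The bracket with \<open>wterm a u\<close>, as an endomorphism of the coefficient space from degree \<open>b\<close> to degree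
  \<open>a + b\<close>.\<close>

definition ladder :: "int ^ 'n::finite \<Rightarrow> 'f::field ^ 'n \<Rightarrow> int ^ 'n \<Rightarrow> 'f ^ 'n \<Rightarrow> 'f ^ 'n" where
  "ladder a u b v = pairing u b *s v - pairing v a *s u"

lemma linear_ladder: "Vector_Spaces.linear (*s) (*s) (ladder a u b)"
  by (auto simp: linear_vec_iff ladder_def vec_eq_iff algebra_simps)

text \<open>Both factors are a multiple of the identity plus a map of rank at most one, so the trace of their
  product is a polynomial in \<open>b\<close>. Its quadratic part is \<open>n\<close> times the product of the linear forms
  \<open>pairing w b\<close> and \<open>pairing u b\<close>, and this is what recovers the vectors up to scalars.\<close>

lemma trace_ladder_down_up:
  fixes u w :: "'f::field ^ 'n::finite"
  shows "trace (matrix (ladder (- a) w (a + b) \<circ> ladder a u b)) =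
    of_nat CARD('n) * (pairing w (a + b) * pairing u b) - pairing w (a + b) * pairing u a
      + pairing u b * pairing w a - pairing u a * pairing w a"
proof -
  define \<alpha> \<beta> where "\<alpha> = pairing w (a + b)" and "\<beta> = pairing u b"
  have "matrix (ladder (- a) w (a + b) \<circ> ladder a u b) $ i $ i =
      \<alpha> * \<beta> - \<alpha> * (u $ i * of_int (a $ i)) + \<beta> * (w $ i * of_int (a $ i))
      - pairing u a * (w $ i * of_int (a $ i))" for i
    by (simp add: matrix_def ladder_def \<alpha>_def[symmetric] \<beta>_def[symmetric] algebra_simps
        del: pairing_simps(7))
  moreover have "(\<Sum>i\<in>UNIV. v $ i * of_int (a $ i)) = pairing v a" for v :: "'f ^ 'n"
    by (simp add: pairing_def)
  ultimately show ?thesis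
    by (simp add: trace_def sum.distrib sum_subtractf del: pairing_simps(7)
        flip: sum_distrib_left \<alpha>_def \<beta>_def)
qed

text \<open>Unique factorization for linear forms: the factors of a nonzero square are multiples of its root.
  Evaluating at axis vectors and their sums gives \<open>s\<^sub>j\<^sup>2 = p\<^sub>j q\<^sub>j\<close> and
  \<open>2 s\<^sub>i s\<^sub>j = p\<^sub>i q\<^sub>j + p\<^sub>j q\<^sub>i\<close>, whence \<open>(p\<^sub>i q\<^sub>j - p\<^sub>j q\<^sub>i)\<^sup>2 = 0\<close>.\<close>

lemma proportional_if_square_eq_product:
  fixes s p q :: "'f::field_char_0 ^ 'n::finite"
  assumes eq: "\<And>b. (pairing s b)\<^sup>2 = pairing p b * pairing q b" and "s \<noteq> 0"
  shows "\<exists>c. p = c *s s"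
proof -
  obtain i where i: "s $ i \<noteq> 0" using \<open>s \<noteq> 0\<close> by (auto simp: vec_eq_iff)
  have diag: "(s $ j)\<^sup>2 = p $ j * q $ j" for j using eq[of "axis j 1"] by simp
  have mixed: "2 * (s $ i * s $ j) = p $ i * q $ j + p $ j * q $ i" for j
    using eq[of "axis i 1 + axis j 1"] diag[of i] diag[of j]
    by (simp add: power2_eq_square algebra_simps)
  have nz: "p $ i \<noteq> 0" "q $ i \<noteq> 0" using diag[of i] i by auto
  have "s $ i * p $ j = p $ i * s $ j" for j
  proof -
    have "(p $ i * q $ j - p $ j * q $ i)\<^sup>2 =
        (p $ i * q $ j + p $ j * q $ i)\<^sup>2 - 4 * ((p $ i * q $ i) * (p $ j * q $ j))"
      by (simp add: power2_eq_square algebra_simps)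
    also have "\<dots> = 0"
      unfolding mixed[symmetric] diag[symmetric] by (simp add: power2_eq_square algebra_simps)
    finally have "p $ i * q $ j = p $ j * q $ i" by simp
    then have m: "p $ j * q $ i = s $ i * s $ j" using mixed[of j] by simp
    have "q $ i * (s $ i * p $ j) = s $ i * (p $ j * q $ i)" by (simp add: mult_ac)
    also have "\<dots> = (s $ i)\<^sup>2 * s $ j" unfolding m by (simp add: power2_eq_square mult_ac)
    also have "\<dots> = q $ i * (p $ i * s $ j)" unfolding diag by (simp add: mult_ac)
    finally have "q $ i * (s $ i * p $ j) = q $ i * (p $ i * s $ j)" .
    then show ?thesis using nz by simp
  qed
  then have "p = (p $ i / s $ i) *s s" using i by (simp add: vec_eq_iff field_simps)
  then show ?thesis by blast
qed

text \<open>The usual argument that a linear map all of whose vectors are eigenvectors is a scalar, relative to an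
  injective \<open>g\<close>: compare the factors at \<open>w\<close>, \<open>v\<close> and \<open>w + v\<close>.\<close>

lemma scalar_multiple_if_pointwise:
  fixes f g :: "'f::field ^ 'n::finite \<Rightarrow> 'f ^ 'n"
  assumes f: "Vector_Spaces.linear (*s) (*s) f" and g: "Vector_Spaces.linear (*s) (*s) g" "inj g"
    and pw: "\<And>u. \<exists>c. f u = c *s g u"
  shows "\<exists>c. \<forall>u. f u = c *s g u"
proof -
  note lf = f[unfolded linear_vec_iff] and lg = g(1)[unfolded linear_vec_iff]
  define w :: "'f ^ 'n" where "w = axis undefined 1"
  have w: "w \<noteq> 0" by (simp add: w_def)
  obtain c where c: "f w = c *s g w" using pw by blast
  have "f v = c *s g v" for v
  proof -
    obtain d e where d: "f v = d *s g v" and e: "f (w + v) = e *s g (w + v)" using pw by metis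
    have "c *s g w + d *s g v = e *s g w + e *s g v"
      using e lf lg c d by (simp add: vec.scale_right_distrib)
    then have "(c - e) *s g w = (e - d) *s g v"
      by (simp add: vec.scale_left_diff_distrib algebra_simps)
    then have "g ((c - e) *s w) = g ((e - d) *s v)" using lg by metis
    then have eq: "(c - e) *s w = (e - d) *s v" by (rule injD[OF g(2)])
    show ?thesis
    proof (cases "e = d")
      case True
      then have "c = e" using eq w by simp
      then show ?thesis using True d by simp
    next
      case False
      then have "v = ((c - e) / (e - d)) *s w" using eq by (simp add: vec_eq_iff field_simps)
      then obtain k where k: "v = k *s w" by blast
      show ?thesis unfolding k using lf lg c by (simp add: mult.commute)
    qed
  qed
  then show ?thesis by blast
qed

section \<open>The structure of automorphisms\<close>

lemma lie_automorphismD: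
  assumes "lie_automorphism witt_scale witt_bracket \<theta>"
  shows "\<theta> (x + y) = \<theta> x + \<theta> y" "\<theta> (witt_scale c x) = witt_scale c (\<theta> x)"
    "\<theta> (witt_bracket x y) = witt_bracket (\<theta> x) (\<theta> y)" "inj \<theta>" "surj \<theta>" "\<theta> 0 = 0"
  using assms by (simp_all add: lie_automorphism_def linear_witt_iff bij_is_inj bij_is_surj)
    (metis add_cancel_right_right)

lemma additive_sum:
  fixes \<theta> :: "'a::ab_group_add \<Rightarrow> 'b::ab_group_add"
  assumes "\<And>x y. \<theta> (x + y) = \<theta> x + \<theta> y"
  shows "\<theta> (sum f I) = (\<Sum>i\<in>I. \<theta> (f i))"
proof -
  have "\<theta> 0 = 0" using assms[of 0 0] by simp
  then show ?thesis by (induction I rule: infinite_finite_induct) (simp_all add: assms)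
qed

lemma lie_automorphism_inv:
  assumes aut: "lie_automorphism witt_scale witt_bracket \<theta>"
  shows "lie_automorphism witt_scale witt_bracket (inv \<theta>)"
proof -
  note * = lie_automorphismD[OF aut]
  have right: "\<theta> (inv \<theta> x) = x" for x by (rule surj_f_inv_f[OF *(5)])
  have eqI: "inv \<theta> x = y" if "\<theta> y = x" for x y using that *(4) by (simp add: inv_f_eq)
  have "bij \<theta>" using *(4,5) by (simp add: bij_def)
  then show ?thesis
    unfolding lie_automorphism_def linear_witt_iff
    by (intro conjI allI bij_imp_bij_inv eqI) (simp_all add: * right)
qed

lemma ad_diagonalizable_automorphism:
  assumes aut: "lie_automorphism witt_scale witt_bracket \<theta>" and x: "ad_diagonalizable x"
  shows "ad_diagonalizable (\<theta> x)"
  unfolding ad_diagonalizable_def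
proof
  note * = lie_automorphismD[OF aut]
  fix y
  obtain z where y: "y = \<theta> z" using *(5) by (metis surjD)
  obtain Y where Y: "finite Y" "\<forall>v\<in>Y. \<exists>c. witt_bracket x v = witt_scale c v" "z = \<Sum>Y"
    using x unfolding ad_diagonalizable_def by blast
  have "y = (\<Sum>v\<in>Y. \<theta> v)" unfolding y Y(3) by (rule additive_sum) (rule *(1))
  also have "\<dots> = \<Sum>(\<theta> ` Y)" using *(4) by (simp add: sum.reindex inj_on_subset)
  finally have "y = \<Sum>(\<theta> ` Y)" .
  moreover have "\<forall>v\<in>\<theta> ` Y. \<exists>c. witt_bracket (\<theta> x) v = witt_scale c v"
  proof
    fix v assume "v \<in> \<theta> ` Y"
    then obtain w where w: "w \<in> Y" "v = \<theta> w" by blast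
    then obtain c where "witt_bracket x w = witt_scale c w" using Y(2) by blast
    then have "witt_bracket (\<theta> x) v = witt_scale c v" using w(2) *(2,3) by metis
    then show "\<exists>c. witt_bracket (\<theta> x) v = witt_scale c v" ..
  qed
  ultimately show "\<exists>Y. finite Y \<and> (\<forall>v\<in>Y. \<exists>c. witt_bracket (\<theta> x) v = witt_scale c v) \<and> y = \<Sum>Y"
    using Y(1) by blast
qed

lemma wsupp_subset_singleton_iff: "wsupp x \<subseteq> {a} \<longleftrightarrow> x = wterm a (wcoeff x a)"
  by (auto simp: wsupp_def witt_eq_iff_wcoeff wcoeff_wterm)

lemma automorphism_degree_zero:
  fixes \<theta> :: "('f::field_char_0, 'n::finite) witt \<Rightarrow> ('f, 'n) witt"
  assumes aut: "lie_automorphism witt_scale witt_bracket \<theta>"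
  shows "\<theta> (wterm 0 u) = wterm 0 (wcoeff (\<theta> (wterm 0 u)) 0)"
  using ad_diagonalizable_imp_degree_zero[OF ad_diagonalizable_automorphism[OF aut ad_diagonalizable_degree_zero]]
  by (simp add: wsupp_subset_singleton_iff)

text \<open>Apply \<open>\<theta>\<close> to the eigenvector equation of \<open>wterm a u\<close> under the bracket with \<open>wterm 0 h\<close>, and compare the
  components of degree \<open>c\<close>.\<close>

lemma automorphism_weight:
  fixes \<theta> :: "('f::field, 'n::finite) witt \<Rightarrow> ('f, 'n) witt"
  assumes aut: "lie_automorphism witt_scale witt_bracket \<theta>"
    and A: "\<And>u. \<theta> (wterm 0 u) = wterm 0 (A u)"
    and c: "c \<in> wsupp (\<theta> (wterm a u))"
  shows "pairing (A h) c = pairing h a"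
proof -
  note * = lie_automorphismD[OF aut]
  have "witt_bracket (wterm 0 (A h)) (\<theta> (wterm a u)) = \<theta> (witt_bracket (wterm 0 h) (wterm a u))"
    by (simp add: * A)
  also have "\<dots> = witt_scale (pairing h a) (\<theta> (wterm a u))"
    by (simp add: witt_bracket_wterm flip: *(2))
  finally have "wcoeff (witt_bracket (wterm 0 (A h)) (\<theta> (wterm a u))) c =
      pairing h a *s wcoeff (\<theta> (wterm a u)) c" by simp
  then have "pairing (A h) c *s wcoeff (\<theta> (wterm a u)) c = pairing h a *s wcoeff (\<theta> (wterm a u)) c"
    using wcoeff_bracket_wterm[of 0 "A h" "\<theta> (wterm a u)" c] by auto
  then show ?thesis using c by (auto simp: wsupp_def)
qed

text \<open>In other words, \<open>\<tau>\<close> is the inverse transpose of \<open>A\<close>. Surjectivity on both sides is enough to make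
  \<open>A\<close> linear and \<open>\<tau>\<close> additive, as the pairing is nondegenerate.\<close>

definition adjoint_pair ::
  "('f::field ^ 'n::finite \<Rightarrow> 'f ^ 'n) \<Rightarrow> (int ^ 'n \<Rightarrow> int ^ 'n) \<Rightarrow> bool" where
  "adjoint_pair A \<tau> \<longleftrightarrow> surj A \<and> surj \<tau> \<and> (\<forall>u a. pairing (A u) (\<tau> a) = pairing u a)"

lemma adjoint_pair_linear:
  assumes "adjoint_pair A \<tau>"
  shows "Vector_Spaces.linear (*s) (*s) A" "inj A"
proof -
  have eqI: "x = y" if "\<And>a. pairing x (\<tau> a) = pairing y (\<tau> a)" for x y
    using assms that by (intro pairing_cancel_left) (metis adjoint_pair_def surjD)
  show "Vector_Spaces.linear (*s) (*s) A"
    unfolding linear_vec_iff by (intro conjI allI eqI) (use assms in \<open>simp_all add: adjoint_pair_def\<close>)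
  show "inj A"
    by (rule injI, rule pairing_cancel_left) (metis assms adjoint_pair_def)
qed

lemma adjoint_pair_additive:
  fixes A :: "'f::field_char_0 ^ 'n::finite \<Rightarrow> 'f ^ 'n"
  assumes "adjoint_pair A \<tau>"
  shows "\<tau> (a + b) = \<tau> a + \<tau> b" "\<tau> (- a) = - \<tau> a" "\<tau> 0 = 0" "inj \<tau>"
proof -
  have eqI: "c = d" if "\<And>u. pairing (A u) c = pairing (A u) d" for c d
    by (rule pairing_cancel_right[where 'f = 'f]) (metis assms adjoint_pair_def surjD that)
  show "\<tau> (a + b) = \<tau> a + \<tau> b" "\<tau> (- a) = - \<tau> a" "\<tau> 0 = 0"
    by (rule eqI, use assms in \<open>simp add: adjoint_pair_def\<close>)+
  show "inj \<tau>"
    by (rule injI, rule pairing_cancel_right[where 'f = 'f]) (metis assms adjoint_pair_def)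
qed

lemma adjoint_pair_0:
  assumes "adjoint_pair A \<tau>"
  shows "A u = 0 \<longleftrightarrow> u = 0"
proof -
  have "A (u - u) = A u - A u"
    using adjoint_pair_linear(1)[OF assms] by (simp add: linear_vec_iff) (metis add_cancel_right_right)
  then have "A 0 = 0" by simp
  then show ?thesis using adjoint_pair_linear(2)[OF assms] by (metis injD)
qed

text \<open>Degree zero is preserved, being the diagonalizable part; hence the simultaneous eigenspaces of the
  degree-zero part, which are the homogeneous components, are permuted. The inverse automorphism provides
  the surjectivity of \<open>A\<close> and of the permutation \<open>\<tau>\<close>.\<close>

lemma automorphism_adjoint_pair:
  fixes \<theta> :: "('f::field_char_0, 'n::finite) witt \<Rightarrow> ('f, 'n) witt"
  assumes aut: "lie_automorphism witt_scale witt_bracket \<theta>"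
  obtains A \<tau> where "adjoint_pair A \<tau>" "\<And>u. \<theta> (wterm 0 u) = wterm 0 (A u)"
    "\<And>a u. \<theta> (wterm a u) = wterm (\<tau> a) (wcoeff (\<theta> (wterm a u)) (\<tau> a))"
proof -
  note * = lie_automorphismD[OF aut]
  note aut' = lie_automorphism_inv[OF aut]
  define A where "A u = wcoeff (\<theta> (wterm 0 u)) 0" for u
  define A' where "A' u = wcoeff (inv \<theta> (wterm 0 u)) 0" for u
  have A: "\<theta> (wterm 0 u) = wterm 0 (A u)" for u
    unfolding A_def by (rule automorphism_degree_zero[OF aut])
  have A': "inv \<theta> (wterm 0 u) = wterm 0 (A' u)" for u
    unfolding A'_def by (rule automorphism_degree_zero[OF aut'])
  have AA': "A (A' u) = u" for u
    using A[of "A' u"] surj_f_inv_f[OF *(5), of "wterm 0 u"] by (simp add: A' wterm_inject)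
  have A'A: "A' (A u) = u" for u
    using A'[of "A u"] inv_f_f[OF *(4), of "wterm 0 u"] by (simp add: A wterm_inject)
  have weight: "\<exists>c. \<forall>h. pairing (F h) c = pairing h a"
    if "lie_automorphism witt_scale witt_bracket \<sigma>" and "\<And>u. \<sigma> (wterm 0 u) = wterm 0 (F u)"
    for \<sigma> :: "('f, 'n) witt \<Rightarrow> ('f, 'n) witt" and F a
  proof -
    define u :: "'f ^ 'n" where "u = axis undefined 1"
    have "wterm a u \<noteq> wterm a 0" unfolding wterm_inject by (simp add: u_def)
    then have "\<sigma> (wterm a u) \<noteq> 0" using lie_automorphismD(4,6)[OF that(1)] by (metis injD wterm_simps(1))
    then obtain c where "c \<in> wsupp (\<sigma> (wterm a u))" by (auto simp: witt_eq_iff_wcoeff wsupp_def)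
    then show ?thesis using automorphism_weight[OF that] by blast
  qed
  obtain \<tau> where \<tau>: "\<And>h a. pairing (A h) (\<tau> a) = pairing h a" using weight[OF aut A] by metis
  have eq_tau: "c = \<tau> a" if "\<And>h. pairing (A h) c = pairing h a" for c a
    by (rule pairing_cancel_right[where 'f = 'f]) (metis that \<tau> AA')
  have "surj \<tau>"
    unfolding surj_def
  proof
    fix c
    obtain b where b: "\<forall>h. pairing (A' h) b = pairing h c" using weight[OF aut' A'] by blast
    have "pairing (A h) c = pairing h b" for h using b[rule_format, of "A h"] by (simp add: A'A)
    then have "c = \<tau> b" by (rule eq_tau)
    then show "\<exists>b. c = \<tau> b" ..
  qed
  moreover have "surj A" using AA' by (metis surjI)
  ultimately have "adjoint_pair A \<tau>" using \<tau> by (simp add: adjoint_pair_def)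
  moreover have "\<theta> (wterm a u) = wterm (\<tau> a) (wcoeff (\<theta> (wterm a u)) (\<tau> a))" for a u
    unfolding wsupp_subset_singleton_iff[symmetric]
    using automorphism_weight[OF aut A] eq_tau by blast
  ultimately show ?thesis using that A by blast
qed

text \<open>On degree \<open>b\<close>, going up with \<open>wterm a u\<close> and down again with \<open>wterm (- a) u\<close> is an endomorphism that
  the automorphism conjugates to the one given by the images of these two elements. The traces agree for
  every \<open>b\<close>; their parts that are quadratic in \<open>b\<close> give the identity.\<close>

lemma automorphism_square_identity:
  fixes \<theta> :: "('f::field_char_0, 'n::finite) witt \<Rightarrow> ('f, 'n) witt"
  assumes aut: "lie_automorphism witt_scale witt_bracket \<theta>"
    and pair: "adjoint_pair A \<tau>"
    and form: "\<And>a u. \<theta> (wterm a u) = wterm (\<tau> a) (B a u)"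
  shows "(pairing (A u) c)\<^sup>2 = pairing (B a u) c * pairing (B (- a) u) c"
    and "Vector_Spaces.linear (*s) (*s) (B a)"
proof -
  note * = lie_automorphismD[OF aut]
  note \<tau> = adjoint_pair_additive[OF pair]
  have lin: "Vector_Spaces.linear (*s) (*s) (B b)" for b
    unfolding linear_vec_iff
  proof (intro conjI allI)
    fix u v
    show "B b (u + v) = B b u + B b v"
      using *(1)[of "wterm b u" "wterm b v"] by (simp add: form wterm_inject)
    fix k
    show "B b (k *s u) = k *s B b u"
      using *(2)[of k "wterm b u"] by (simp add: form wterm_inject)
  qed
  then show "Vector_Spaces.linear (*s) (*s) (B a)" .
  have inj: "inj (B b)" for b
    by (rule injI) (metis *(4) form injD wterm_inject)
  define p q where "p = B a u" and "q = B (- a) u"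
  note linear_ladders = Vector_Spaces.linear_compose[OF linear_ladder linear_ladder]
  have trace_eq: "trace (matrix (ladder (- a) u (a + b) \<circ> ladder a u b)) =
      trace (matrix (ladder (- \<tau> a) q (\<tau> a + \<tau> b) \<circ> ladder (\<tau> a) p (\<tau> b)))" for b
  proof (rule trace_eq_if_conjugate[OF lin linear_ladders linear_ladders inj])
    fix v
    have "wterm (\<tau> b) (B b ((ladder (- a) u (a + b) \<circ> ladder a u b) v)) =
        \<theta> (witt_bracket (wterm (- a) u) (witt_bracket (wterm a u) (wterm b v)))"
      by (simp add: witt_bracket_wterm ladder_def form)
    also have "\<dots> = witt_bracket (wterm (- \<tau> a) q) (witt_bracket (wterm (\<tau> a) p) (wterm (\<tau> b) (B b v)))"
      by (simp add: * form p_def q_def \<tau>)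
    also have "\<dots> = wterm (\<tau> b) ((ladder (- \<tau> a) q (\<tau> a + \<tau> b) \<circ> ladder (\<tau> a) p (\<tau> b)) (B b v))"
      by (simp add: witt_bracket_wterm ladder_def)
    finally show "B b ((ladder (- a) u (a + b) \<circ> ladder a u b) v) =
        (ladder (- \<tau> a) q (\<tau> a + \<tau> b) \<circ> ladder (\<tau> a) p (\<tau> b)) (B b v)"
      by (simp only: wterm_inject)
  qed
  obtain b where c: "c = \<tau> b" using pair by (metis adjoint_pair_def surjD)
  define N :: 'f where "N = of_nat CARD('n)"
  define X Y where "X = pairing u b" and "Y = pairing u a"
  define P P' Q Q' where "P = pairing p (\<tau> a)" and "P' = pairing p (\<tau> b)"
    and "Q = pairing q (\<tau> a)" and "Q' = pairing q (\<tau> b)"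
  have "N \<noteq> 0" by (simp add: N_def)
  note trace = trace_eq[unfolded trace_ladder_down_up]
  \<comment> \<open>The quadratic part is isolated by the second difference over \<open>b\<close>, \<open>0\<close>, \<open>- b\<close>.\<close>
  have "N * ((Y + X) * X) - (Y + X) * Y + X * Y - Y * Y =
      N * ((Q + Q') * P') - (Q + Q') * P + P' * Q - P * Q"
    using trace[of b] by (simp add: N_def X_def Y_def P_def P'_def Q_def Q'_def)
  moreover have "N * ((Y - X) * (- X)) - (Y - X) * Y + (- X) * Y - Y * Y =
      N * ((Q - Q') * (- P')) - (Q - Q') * P + (- P') * Q - P * Q"
    using trace[of "- b"] by (simp add: \<tau> N_def X_def Y_def P_def P'_def Q_def Q'_def)
  moreover have "- (Y * Y) - Y * Y = - (Q * P) - P * Q"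
    using trace[of 0] by (simp add: \<tau> Y_def P_def Q_def)
  ultimately have "2 * N * (X * X) = 2 * N * (P' * Q')" by algebra
  then have "X * X = P' * Q'" using \<open>N \<noteq> 0\<close> by simp
  moreover have "pairing (A u) c = X" using pair by (simp add: c X_def adjoint_pair_def)
  ultimately show "(pairing (A u) c)\<^sup>2 = pairing (B a u) c * pairing (B (- a) u) c"
    by (simp add: power2_eq_square c P'_def Q'_def p_def q_def)
qed

text \<open>The shape \<open>t\<^sup>a u \<mapsto> \<kappa>(a) t\<^bsup>\<tau>(a)\<^esup> A(u)\<close>. The scalars \<open>\<kappa>\<close> are kept free of any multiplicativity
  condition, so that linear maps not yet known to respect the bracket can have this shape as well.\<close>

definition graded_form ::
  "(('f::field, 'n::finite) witt \<Rightarrow> ('f, 'n) witt) \<Rightarrow> ('f ^ 'n \<Rightarrow> 'f ^ 'n) \<Rightarrow> (int ^ 'n \<Rightarrow> int ^ 'n) \<Rightarrow>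
    (int ^ 'n \<Rightarrow> 'f) \<Rightarrow> bool" where
  "graded_form \<theta> A \<tau> \<kappa> \<longleftrightarrow> adjoint_pair A \<tau> \<and> \<kappa> 0 = 1 \<and> (\<forall>a. \<kappa> a \<noteq> 0) \<and>
    (\<forall>a u. \<theta> (wterm a u) = wterm (\<tau> a) (\<kappa> a *s A u))"

text \<open>The coefficient map in each degree is pointwise, hence globally, proportional to \<open>A\<close>: the square
  identity exhibits the form of \<open>B a u\<close> as a factor of the square of that of \<open>A u\<close>. The bracket of
  \<open>wterm a u\<close> and \<open>wterm b u\<close> then shows that the proportionality factors are multiplicative when
  \<open>a \<noteq> b\<close>. In rank one each homogeneous component is abelian, so for \<open>a = b\<close> the bracket
  gives nothing, and multiplicativity is derived from \<open>(2 a) + (- a) = a\<close> instead.\<close>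

theorem automorphism_graded_form:
  fixes \<theta> :: "('f::field_char_0, 'n::finite) witt \<Rightarrow> ('f, 'n) witt"
  assumes aut: "lie_automorphism witt_scale witt_bracket \<theta>"
  obtains A \<tau> \<kappa> where "graded_form \<theta> A \<tau> \<kappa>" "\<And>a b. \<kappa> (a + b) = \<kappa> a * \<kappa> b"
proof -
  note * = lie_automorphismD[OF aut]
  obtain A \<tau> where pair: "adjoint_pair A \<tau>" and A: "\<And>u. \<theta> (wterm 0 u) = wterm 0 (A u)"
    and form: "\<And>a u. \<theta> (wterm a u) = wterm (\<tau> a) (wcoeff (\<theta> (wterm a u)) (\<tau> a))"
    using automorphism_adjoint_pair[OF aut] by blast
  define B where "B a u = wcoeff (\<theta> (wterm a u)) (\<tau> a)" for a u
  have B: "\<theta> (wterm a u) = wterm (\<tau> a) (B a u)" for a u unfolding B_def by (rule form)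
  note sq = automorphism_square_identity[OF aut pair B]
  note linA = adjoint_pair_linear[OF pair]
  note \<tau> = adjoint_pair_additive[OF pair]
  note A0 = adjoint_pair_0[OF pair]
  have "\<exists>c. \<forall>u. B a u = c *s A u" for a
  proof (rule scalar_multiple_if_pointwise[OF sq(2) linA])
    fix u
    show "\<exists>c. B a u = c *s A u"
    proof (cases "u = 0")
      case True
      then have "B a u = 0 *s A u" using * by (simp add: B_def)
      then show ?thesis ..
    next
      case False
      show ?thesis by (rule proportional_if_square_eq_product[OF sq(1)]) (simp add: A0 False)
    qed
  qed
  then obtain \<kappa> where "\<And>a u. B a u = \<kappa> a *s A u" by metis
  with B have \<kappa>: "\<theta> (wterm a u) = wterm (\<tau> a) (\<kappa> a *s A u)" for a u by simp
  define w :: "'f ^ 'n" where "w = axis undefined 1"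
  have w: "A w \<noteq> 0" by (simp add: A0) (simp add: w_def)
  have nz: "\<kappa> a \<noteq> 0" for a
  proof
    assume "\<kappa> a = 0"
    then have "\<theta> (wterm a w) = \<theta> 0" by (simp add: \<kappa> *(6))
    then have "wterm a w = wterm a 0" using *(4) by (simp add: injD)
    then have "w = 0" by (simp only: wterm_inject)
    then show False by (simp add: w_def)
  qed
  have one: "\<kappa> 0 = 1"
  proof -
    have "1 *s A w = \<kappa> 0 *s A w" using A[of w] \<kappa>[of 0 w] by (simp add: \<tau> wterm_inject)
    then show ?thesis using w by (simp only: vec.scale_cancel_right) simp
  qed
  have distinct: "\<kappa> (a + b) = \<kappa> a * \<kappa> b" if ne: "a \<noteq> b" for a b
  proof -
    obtain u :: "'f ^ 'n" where "pairing u b \<noteq> pairing u a"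
      using ne pairing_cancel_right[where 'f = 'f, of a b] by metis
    moreover from this have "A u \<noteq> 0" by (auto simp: A0)
    moreover have "wterm (\<tau> a + \<tau> b) ((\<kappa> (a + b) * (pairing u b - pairing u a)) *s A u) =
        \<theta> (witt_bracket (wterm a u) (wterm b u))"
    proof -
      have "witt_bracket (wterm a u) (wterm b u) = wterm (a + b) ((pairing u b - pairing u a) *s u)"
        by (simp add: witt_bracket_wterm vec.scale_left_diff_distrib)
      then show ?thesis using linA(1) by (simp add: \<kappa> \<tau> linear_vec_iff)
    qed
    moreover have "\<theta> (witt_bracket (wterm a u) (wterm b u)) =
        wterm (\<tau> a + \<tau> b) ((\<kappa> a * \<kappa> b * (pairing u b - pairing u a)) *s A u)"
    proof -
      have "pairing (A u) (\<tau> c) = pairing u c" for c using pair by (simp add: adjoint_pair_def)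
      then show ?thesis
        unfolding *(3) by (simp add: \<kappa> witt_bracket_wterm wterm_inject) (simp add: vec_eq_iff algebra_simps)
    qed
    ultimately show ?thesis by (simp add: wterm_inject)
  qed
  have "\<kappa> (a + b) = \<kappa> a * \<kappa> b" for a b
  proof (cases "a = b")
    case True
    show ?thesis
    proof (cases "a = 0")
      case False
      then have ne: "a \<noteq> - a" "a + a \<noteq> - a" by (auto simp: vec_eq_iff)
      have "\<kappa> (a + a) * \<kappa> (- a) = \<kappa> a" using distinct[OF ne(2)] by simp
      moreover have "\<kappa> a * \<kappa> (- a) = 1" using distinct[OF ne(1)] one by simp
      ultimately have "\<kappa> (- a) * \<kappa> (a + a) = \<kappa> (- a) * (\<kappa> a * \<kappa> a)" by (simp add: mult_ac)
      then show ?thesis using nz[of "- a"] True by simp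
    qed (use True one in simp)
  qed (rule distinct)
  moreover have "graded_form \<theta> A \<tau> \<kappa>" using pair one nz \<kappa> by (simp add: graded_form_def)
  ultimately show ?thesis using that by blast
qed

text \<open>The bracket of homogeneous elements involves only the pairing, the addition of degrees and the scalars,
  all of which are respected.\<close>

lemma automorphism_if_graded_form:
  fixes \<Phi> :: "('f::field_char_0, 'n::finite) witt \<Rightarrow> ('f, 'n) witt"
  assumes lin: "Vector_Spaces.linear witt_scale witt_scale \<Phi>" and inj: "inj \<Phi>"
    and form: "graded_form \<Phi> A \<tau> \<kappa>" and hom: "\<And>a b. \<kappa> (a + b) = \<kappa> a * \<kappa> b"
  shows "lie_automorphism witt_scale witt_bracket \<Phi>"
proof -
  have pair: "adjoint_pair A \<tau>" and \<Phi>: "\<And>a u. \<Phi> (wterm a u) = wterm (\<tau> a) (\<kappa> a *s A u)"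
    and nz: "\<And>a. \<kappa> a \<noteq> 0"
    using form by (simp_all add: graded_form_def)
  note linA = adjoint_pair_linear(1)[OF pair, unfolded linear_vec_iff]
  note \<tau> = adjoint_pair_additive[OF pair]
  have \<Phi>_add: "\<Phi> (x + y) = \<Phi> x + \<Phi> y" for x y using lin by (simp add: linear_witt_iff)
  have \<Phi>_zero: "\<Phi> 0 = 0" using \<Phi>_add[of 0 0] by simp
  have A_diff: "A (u - v) = A u - A v" for u v
    using linA by (metis add_diff_cancel diff_add_cancel)
  have "\<Phi> (witt_bracket (wterm a u) (wterm b v)) = witt_bracket (\<Phi> (wterm a u)) (\<Phi> (wterm b v))" for a b u v
  proof -
    have "pairing (A x) (\<tau> c) = pairing x c" for x c using pair by (simp add: adjoint_pair_def)
    then show ?thesis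
      using linA by (simp add: witt_bracket_wterm \<Phi> \<tau> hom A_diff vec.scale_right_diff_distrib mult_ac)
  qed
  then have "\<Phi> (witt_bracket (wterm a u) y) = witt_bracket (\<Phi> (wterm a u)) (\<Phi> y)" for a u y
    by (induction y rule: witt_induct) (simp_all add: \<Phi>_zero \<Phi>_add)
  then have "\<Phi> (witt_bracket x y) = witt_bracket (\<Phi> x) (\<Phi> y)" for x y
    by (induction x rule: witt_induct) (simp_all add: \<Phi>_zero \<Phi>_add)
  moreover have "x \<in> range \<Phi>" for x
  proof (induction x rule: witt_induct)
    case zero
    show ?case using \<Phi>_zero by (metis rangeI)
  next
    case (wterm c v)
    obtain a u where "\<tau> a = c" "A u = inverse (\<kappa> a) *s v"
      using pair unfolding adjoint_pair_def by (metis surjD)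
    then have "\<Phi> (wterm a u) = wterm c v" using nz[of a] by (simp add: \<Phi>)
    then show ?case by (metis rangeI)
  next
    case (add x y)
    then show ?case by (auto simp flip: \<Phi>_add)
  qed
  then have "surj \<Phi>" by blast
  ultimately show ?thesis using lin inj by (simp add: lie_automorphism_def bij_def)
qed

section \<open>Automorphisms are determined by a single value\<close>

text \<open>The component of the common value in degree \<open>0\<close> is \<open>A h = A' h\<close>. Degrees are then recognised by their
  pairing with this vector: if \<open>\<tau>' s = \<tau> r\<close>, then \<open>pairing h s = pairing h r\<close>, so \<open>s = r\<close> by
  separation. Finally the components in equal degrees give the scalars.\<close>

lemma graded_form_rigid:
  fixes \<theta> \<theta>' :: "('f::field_char_0, 'n::finite) witt \<Rightarrow> ('f, 'n) witt"
  assumes form: "graded_form \<theta> A \<tau> \<kappa>" "graded_form \<theta>' A' \<tau>' \<kappa>'"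
    and add: "\<And>x y. \<theta> (x + y) = \<theta> x + \<theta> y" "\<And>x y. \<theta>' (x + y) = \<theta>' x + \<theta>' y"
    and S: "finite S" "0 \<in> S" and h: "separates h S"
    and eq: "\<theta> (\<Sum>s\<in>S. wterm s h) = \<theta>' (\<Sum>s\<in>S. wterm s h)"
  shows "A h = A' h" and "\<And>s. s \<in> S \<Longrightarrow> \<tau> s = \<tau>' s \<and> \<kappa> s = \<kappa>' s"
proof -
  have image_coeff: "wcoeff (\<sigma> (\<Sum>s\<in>S. wterm s h)) c =
      (\<Sum>s\<in>S. if c = \<rho> s then \<mu> s *s F h else 0)"
    if "graded_form \<sigma> F \<rho> \<mu>" "\<And>x y. \<sigma> (x + y) = \<sigma> x + \<sigma> y" for \<sigma> F \<rho> \<mu> c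
    using that(1) by (simp add: additive_sum[OF that(2)] wcoeff_sum graded_form_def wcoeff_wterm)
  have at: "wcoeff (\<sigma> (\<Sum>s\<in>S. wterm s h)) (\<rho> s) = \<mu> s *s F h"
    if "graded_form \<sigma> F \<rho> \<mu>" "\<And>x y. \<sigma> (x + y) = \<sigma> x + \<sigma> y" "s \<in> S"
    for \<sigma> :: "('f, 'n) witt \<Rightarrow> ('f, 'n) witt" and F \<rho> \<mu> s
  proof -
    have "inj \<rho>" using that(1) adjoint_pair_additive(4) by (auto simp: graded_form_def)
    then have "\<rho> s = \<rho> r \<longleftrightarrow> r = s" for r by (auto simp: inj_eq)
    then show ?thesis unfolding image_coeff[OF that(1,2)] using S(1) that(3) by simp
  qed
  have pair: "adjoint_pair A \<tau>" "adjoint_pair A' \<tau>'" "\<kappa> 0 = 1" "\<kappa>' 0 = 1" "\<And>a. \<kappa>' a \<noteq> 0"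
    using form by (simp_all add: graded_form_def)
  have zero: "\<tau> 0 = 0" "\<tau>' 0 = 0" using pair adjoint_pair_additive(3) by blast+
  show Ah: "A h = A' h"
    using at[OF form(1) add(1) S(2)] at[OF form(2) add(2) S(2)] eq pair by (simp add: zero)
  have "h \<noteq> 0" using h by (simp add: separates_def)
  then have nz: "A' h \<noteq> 0" using adjoint_pair_0[OF pair(2)] by simp
  fix s assume s: "s \<in> S"
  have "wcoeff (\<theta> (\<Sum>s\<in>S. wterm s h)) (\<tau>' s) \<noteq> 0"
    using at[OF form(2) add(2) s] nz pair(5)[of s] by (simp add: eq)
  then obtain r where r: "r \<in> S" "\<tau>' s = \<tau> r"
    unfolding image_coeff[OF form(1) add(1)] by (auto elim!: sum.not_neutral_contains_not_neutral split: if_splits)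
  have "pairing h s = pairing (A' h) (\<tau>' s)" using pair(2) by (simp add: adjoint_pair_def)
  also have "\<dots> = pairing h r" using pair(1) by (simp add: r(2) Ah[symmetric] adjoint_pair_def)
  finally have "s = r" using h s r(1) by (auto simp: separates_def dest: inj_onD)
  then have \<tau>: "\<tau> s = \<tau>' s" using r(2) by simp
  have "\<kappa> s *s A' h = \<kappa>' s *s A' h"
    using at[OF form(1) add(1) s] at[OF form(2) add(2) s] by (auto simp: eq \<tau> Ah)
  then show "\<tau> s = \<tau>' s \<and> \<kappa> s = \<kappa>' s" using \<tau> nz by auto
qed

text \<open>The test element is \<open>\<Sum>s\<in>S. wterm s h\<close>, where \<open>S\<close> consists of \<open>0\<close> and the axis vectors and \<open>h\<close> separates
  \<open>S\<close>. By rigidity its image fixes the permutation of degrees and the scalars on generators of the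
  lattice, hence everywhere, and the adjoint pairing then fixes \<open>A\<close>.\<close>

lemma automorphism_determined_by_one_value:
  obtains x0 :: "('f::field_char_0, 'n::finite) witt" where
    "\<And>\<theta> \<theta>'. lie_automorphism witt_scale witt_bracket \<theta> \<Longrightarrow>
      lie_automorphism witt_scale witt_bracket \<theta>' \<Longrightarrow> \<theta> x0 = \<theta>' x0 \<Longrightarrow> \<theta> = \<theta>'"
proof -
  define S :: "(int ^ 'n) set" where "S = insert 0 (range (\<lambda>i. axis i 1))"
  have S: "finite S" "0 \<in> S" by (simp_all add: S_def)
  obtain h :: "'f ^ 'n" where h: "separates h S" using ex_separates[OF S(1)] by blast
  have "\<theta> = \<theta>'"
    if aut: "lie_automorphism witt_scale witt_bracket \<theta>" "lie_automorphism witt_scale witt_bracket \<theta>'"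
      and eq: "\<theta> (\<Sum>s\<in>S. wterm s h) = \<theta>' (\<Sum>s\<in>S. wterm s h)" for \<theta> \<theta>'
  proof -
    obtain A \<tau> \<kappa> where form: "graded_form \<theta> A \<tau> \<kappa>" and hom: "\<And>a b. \<kappa> (a + b) = \<kappa> a * \<kappa> b"
      using automorphism_graded_form[OF aut(1)] by blast
    obtain A' \<tau>' \<kappa>' where form': "graded_form \<theta>' A' \<tau>' \<kappa>'" and hom': "\<And>a b. \<kappa>' (a + b) = \<kappa>' a * \<kappa>' b"
      using automorphism_graded_form[OF aut(2)] by blast
    have pair: "adjoint_pair A \<tau>" "adjoint_pair A' \<tau>'" "\<kappa> 0 = 1" "\<kappa>' 0 = 1" "\<And>a. \<kappa> a \<noteq> 0"
      using form form' by (simp_all add: graded_form_def)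
    note \<tau> = adjoint_pair_additive[OF pair(1)] and \<tau>' = adjoint_pair_additive[OF pair(2)]
    have agree: "\<tau> s = \<tau>' s \<and> \<kappa> s = \<kappa>' s" if "s \<in> S" for s
      by (rule graded_form_rigid(2)[OF form form' _ _ S h eq that])
        (simp_all add: lie_automorphismD[OF aut(1)] lie_automorphismD[OF aut(2)])
    have same: "\<tau> a = \<tau>' a \<and> \<kappa> a = \<kappa>' a" for a
    proof (induction a rule: exponent_induct)
      case (axis i)
      show ?case by (rule agree) (simp add: S_def)
    next
      case (add a b)
      then show ?case by (simp add: \<tau> \<tau>' hom hom')
    next
      case (uminus a)
      have "\<kappa> a * \<kappa> (- a) = 1" "\<kappa>' a * \<kappa>' (- a) = 1"
        using hom[of a "- a"] hom'[of a "- a"] pair by simp_all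
      then have "\<kappa> a * \<kappa> (- a) = \<kappa> a * \<kappa>' (- a)" using uminus by simp
      then show ?case using uminus pair(5)[of a] by (simp add: \<tau> \<tau>')
    qed
    have "A u = A' u" for u
    proof (rule pairing_cancel_left)
      fix c
      obtain a where "c = \<tau> a" using pair(1) by (metis adjoint_pair_def surjD)
      then show "pairing (A u) c = pairing (A' u) c"
        using pair same by (metis adjoint_pair_def)
    qed
    then have "\<theta> (wterm a u) = \<theta>' (wterm a u)" for a u
      using form form' same by (simp add: graded_form_def)
    then have "\<theta> x = \<theta>' x" for x
      by (induction x rule: witt_induct)
        (simp_all add: lie_automorphismD[OF aut(1)] lie_automorphismD[OF aut(2)])
    then show ?thesis by blast
  qed
  then show ?thesis by (rule that)
qed

section \<open>2-local and local automorphisms\<close>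

lemma two_local_imp_automorphism:
  fixes \<Phi> :: "('f::field_char_0, 'n::finite) witt \<Rightarrow> ('f, 'n) witt"
  assumes "two_local_lie_automorphism witt_scale witt_bracket \<Phi>"
  shows "lie_automorphism witt_scale witt_bracket \<Phi>"
proof -
  obtain x0 :: "('f, 'n) witt" where x0:
    "\<And>\<theta> \<theta>'. lie_automorphism witt_scale witt_bracket \<theta> \<Longrightarrow>
      lie_automorphism witt_scale witt_bracket \<theta>' \<Longrightarrow> \<theta> x0 = \<theta>' x0 \<Longrightarrow> \<theta> = \<theta>'"
    using automorphism_determined_by_one_value by blast
  have "\<exists>\<theta>. lie_automorphism witt_scale witt_bracket \<theta> \<and> \<Phi> x0 = \<theta> x0 \<and> \<Phi> y = \<theta> y" for y
    using assms by (simp add: two_local_lie_automorphism_def)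
  then obtain \<Theta> where \<Theta>: "\<And>y. lie_automorphism witt_scale witt_bracket (\<Theta> y)"
    "\<And>y. \<Phi> x0 = \<Theta> y x0" "\<And>y. \<Phi> y = \<Theta> y y" by metis
  have "\<Theta> y = \<Theta> x0" for y using x0[OF \<Theta>(1) \<Theta>(1)] \<Theta>(2) by metis
  then have "\<Phi> = \<Theta> x0" using \<Theta>(3) by (metis ext)
  then show ?thesis using \<Theta>(1) by simp
qed

text \<open>On degree zero, \<open>\<Phi>\<close> is a linear injection \<open>A\<close>, bijective for dimension reasons. For \<open>a \<noteq> 0\<close> the
  automorphism chosen for \<open>wterm 0 h + wterm a u\<close> agrees with \<open>A\<close> at \<open>h\<close>, so the degree \<open>c\<close> of
  \<open>\<Phi> (wterm a u)\<close> satisfies \<open>pairing (A h) c = pairing h a\<close>. As \<open>h\<close> is arbitrary, this determines \<open>c\<close> from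
  \<open>a\<close>; the particular choice \<open>h = u\<close> makes \<open>\<Phi> (wterm a u)\<close> a multiple of \<open>A u\<close> in that degree.\<close>

lemma local_graded_form:
  fixes \<Phi> :: "('f::field_char_0, 'n::finite) witt \<Rightarrow> ('f, 'n) witt"
  assumes lin: "Vector_Spaces.linear witt_scale witt_scale \<Phi>" and inj: "inj \<Phi>"
    and loc: "\<And>x. \<exists>\<theta>. lie_automorphism witt_scale witt_bracket \<theta> \<and> \<Phi> x = \<theta> x"
  obtains A \<tau> \<kappa> where "graded_form \<Phi> A \<tau> \<kappa>"
proof -
  have add: "\<Phi> (x + y) = \<Phi> x + \<Phi> y" and scale: "\<Phi> (witt_scale c x) = witt_scale c (\<Phi> x)" for x y c
    using lin by (simp_all add: linear_witt_iff)
  have locg: "\<exists>\<theta> A \<tau> \<kappa>. \<Phi> x = \<theta> x \<and> graded_form \<theta> A \<tau> \<kappa> \<and> (\<forall>x y. \<theta> (x + y) = \<theta> x + \<theta> y)" for x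
    using loc[of x] automorphism_graded_form lie_automorphismD(1) by metis
  have graded_zero: "\<tau> 0 = 0 \<and> \<theta> (wterm 0 u) = wterm 0 (A u)" if "graded_form \<theta> A \<tau> \<kappa>"
    for \<theta> :: "('f, 'n) witt \<Rightarrow> ('f, 'n) witt" and A \<tau> \<kappa> u
    using that adjoint_pair_additive(3)[of A \<tau>] by (simp add: graded_form_def)
  define A where "A u = wcoeff (\<Phi> (wterm 0 u)) 0" for u
  have A: "\<Phi> (wterm 0 u) = wterm 0 (A u)" for u
    unfolding A_def using locg[of "wterm 0 u"] graded_zero by (metis wcoeff_wterm)
  have linA: "Vector_Spaces.linear (*s) (*s) A"
    by (simp add: linear_vec_iff A_def add scale flip: wterm_simps)
  have injA: "inj A" by (rule injI) (metis A inj injD wterm_inject)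
  have surjA: "surj A" by (rule vec.linear_inj_imp_surj[OF linA injA])
  have test: "\<exists>A' \<tau>' \<kappa>'. adjoint_pair A' \<tau>' \<and> A' h = A h \<and> \<Phi> (wterm a u) = wterm (\<tau>' a) (\<kappa>' *s A' u)"
    if a: "a \<noteq> 0" for a h u
  proof -
    obtain \<theta> A1 \<tau>1 \<kappa>1 where 1: "\<Phi> (wterm 0 h + wterm a u) = \<theta> (wterm 0 h + wterm a u)"
      "graded_form \<theta> A1 \<tau>1 \<kappa>1" "\<forall>x y. \<theta> (x + y) = \<theta> x + \<theta> y" using locg by blast
    obtain \<theta>2 A2 \<tau>2 \<kappa>2 where 2: "\<Phi> (wterm a u) = \<theta>2 (wterm a u)"
      "graded_form \<theta>2 A2 \<tau>2 \<kappa>2" using locg by blast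
    have eq: "wterm 0 (A h) + wterm (\<tau>2 a) (\<kappa>2 a *s A2 u) = wterm 0 (A1 h) + wterm (\<tau>1 a) (\<kappa>1 a *s A1 u)"
      using 1 2 A graded_zero[OF 1(2)] by (simp add: add graded_form_def)
    have "\<tau>1 a \<noteq> 0" "\<tau>2 a \<noteq> 0"
      using 1(2) 2(2) a adjoint_pair_additive(3,4) unfolding graded_form_def by (metis injD)+
    then have h: "A1 h = A h" using arg_cong[OF eq, of "\<lambda>x. wcoeff x 0"] by (simp add: wcoeff_wterm)
    then have "\<Phi> (wterm a u) = wterm (\<tau>1 a) (\<kappa>1 a *s A1 u)" using eq 2 by (simp add: graded_form_def)
    then show ?thesis using h 1(2) unfolding graded_form_def by blast
  qed
  have weight: "pairing (A h) c = pairing h a"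
    if a: "a \<noteq> 0" and c: "wcoeff (\<Phi> (wterm a u)) c \<noteq> 0" for a c h u
  proof -
    obtain A' \<tau>' \<kappa>' where t: "adjoint_pair A' \<tau>'" "A' h = A h"
      "\<Phi> (wterm a u) = wterm (\<tau>' a) (\<kappa>' *s A' u)" using test[OF a] by blast
    then have "c = \<tau>' a" using c by (auto simp: wcoeff_wterm split: if_splits)
    then show ?thesis using t by (metis adjoint_pair_def)
  qed
  have "\<exists>c. \<forall>h. pairing (A h) c = pairing h a" for a
  proof (cases "a = 0")
    case False
    define w :: "'f ^ 'n" where "w = axis undefined 1"
    have "wterm a w \<noteq> wterm a 0" unfolding wterm_inject by (simp add: w_def)
    moreover have "\<Phi> 0 = 0" using add[of 0 0] by simp
    ultimately have "\<Phi> (wterm a w) \<noteq> 0" using inj by (metis injD wterm_simps(1))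
    then obtain c where c: "wcoeff (\<Phi> (wterm a w)) c \<noteq> 0" by (auto simp: witt_eq_iff_wcoeff)
    show ?thesis using weight[OF False c] by blast
  qed (auto intro: exI[of _ 0])
  then obtain \<tau> where \<tau>: "\<And>h a. pairing (A h) (\<tau> a) = pairing h a" by metis
  have eq_tau: "c = \<tau> a" if "\<And>h. pairing (A h) c = pairing h a" for c a
    by (rule pairing_cancel_right[where 'f = 'f]) (metis that \<tau> surjA surjD)
  have "surj \<tau>"
    unfolding surj_def
  proof
    fix c
    \<comment> \<open>\<open>A\<close> agrees with some automorphism on each axis vector, and automorphisms
      send axis vectors to integral vectors: their \<open>\<tau>\<close> is onto the lattice.\<close>
    have "\<exists>m. pairing (A (axis i 1)) c = of_int m" for i
    proof -
      obtain \<theta> A1 \<tau>1 \<kappa>1 where 1: "\<Phi> (wterm 0 (axis i 1)) = \<theta> (wterm 0 (axis i 1))"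
        "graded_form \<theta> A1 \<tau>1 \<kappa>1" using locg by blast
      then have "A1 (axis i 1) = A (axis i 1)"
        using A graded_zero[OF 1(2)] by (metis wterm_inject)
      moreover obtain a where "c = \<tau>1 a" using 1(2) by (metis graded_form_def adjoint_pair_def surjD)
      ultimately have "pairing (A (axis i 1)) c = pairing (axis i 1) a"
        using 1(2) by (metis graded_form_def adjoint_pair_def)
      then show ?thesis by auto
    qed
    then obtain m where m: "\<And>i. pairing (A (axis i 1)) c = of_int (m i)" by metis
    have "pairing (A u) c = pairing u (\<chi> i. m i)" for u
    proof -
      have "A u = A (\<Sum>i\<in>UNIV. u $ i *s axis i 1)" by (simp only: basis_expansion)
      also have "\<dots> = (\<Sum>i\<in>UNIV. u $ i *s A (axis i 1))"
        using linA by (simp add: additive_sum linear_vec_iff)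
      finally have "pairing (A u) c = (\<Sum>i\<in>UNIV. u $ i * pairing (A (axis i 1)) c)"
        by (simp add: additive_sum[of "\<lambda>x. pairing x c"])
      then show ?thesis by (simp add: m) (simp add: pairing_def)
    qed
    then have "c = \<tau> (\<chi> i. m i)" by (rule eq_tau)
    then show "\<exists>a. c = \<tau> a" ..
  qed
  then have pair: "adjoint_pair A \<tau>" using surjA \<tau> by (simp add: adjoint_pair_def)
  have pw: "\<exists>k. \<Phi> (wterm a u) = wterm (\<tau> a) (k *s A u)" for a u
  proof (cases "a = 0")
    case True
    then have "\<Phi> (wterm a u) = wterm (\<tau> a) (1 *s A u)"
      using A adjoint_pair_additive(3)[OF pair] by simp
    then show ?thesis ..
  next
    case False
    obtain A' \<tau>' k where t: "adjoint_pair A' \<tau>'" "A' u = A u"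
      "\<Phi> (wterm a u) = wterm (\<tau>' a) (k *s A' u)" using test[OF False] by blast
    show ?thesis
    proof (cases "k *s A' u = 0")
      case True
      then have "\<Phi> (wterm a u) = wterm (\<tau> a) (0 *s A u)" using t(3) by auto
      then show ?thesis ..
    next
      case nz: False
      then have "wcoeff (\<Phi> (wterm a u)) (\<tau>' a) \<noteq> 0" by (simp only: t(3) wcoeff_wterm) simp
      then have "\<tau>' a = \<tau> a" using weight[OF False] eq_tau by blast
      then show ?thesis using t by metis
    qed
  qed
  have "\<exists>k. \<forall>u. wcoeff (\<Phi> (wterm a u)) (\<tau> a) = k *s A u" for a
  proof (rule scalar_multiple_if_pointwise[OF _ linA injA])
    show "Vector_Spaces.linear (*s) (*s) (\<lambda>u. wcoeff (\<Phi> (wterm a u)) (\<tau> a))"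
      by (simp add: linear_vec_iff add scale flip: wterm_simps)
    show "\<exists>k. wcoeff (\<Phi> (wterm a u)) (\<tau> a) = k *s A u" for u
      using pw[of a u] by (metis wcoeff_wterm)
  qed
  then obtain k where k: "\<And>a u. wcoeff (\<Phi> (wterm a u)) (\<tau> a) = k a *s A u" by metis
  have form: "\<Phi> (wterm a u) = wterm (\<tau> a) (k a *s A u)" for a u
    using pw[of a u] k[of a u] by (metis wcoeff_wterm)
  define w :: "'f ^ 'n" where "w = axis undefined 1"
  have w: "w \<noteq> 0" by (simp add: w_def)
  have "k a \<noteq> 0" for a
  proof
    assume "k a = 0"
    moreover have "\<Phi> 0 = 0" using add[of 0 0] by simp
    ultimately have "\<Phi> (wterm a w) = \<Phi> (wterm a 0)" by (simp add: form)
    then have "wterm a w = wterm a 0" by (rule injD[OF inj])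
    then show False using w by (simp only: wterm_inject)
  qed
  moreover have "k 0 = 1"
  proof -
    have "1 *s A w = k 0 *s A w"
      using A[of w] form[of 0 w] adjoint_pair_additive(3)[OF pair] by (simp add: wterm_inject)
    moreover have "A w \<noteq> 0" using w by (simp add: adjoint_pair_0[OF pair])
    ultimately show ?thesis by (simp only: vec.scale_cancel_right) simp
  qed
  ultimately have "graded_form \<Phi> A \<tau> k" using pair form by (simp add: graded_form_def)
  then show ?thesis by (rule that)
qed

text \<open>What remains is the multiplicativity of \<open>\<kappa>\<close>. An automorphism agreeing with \<open>\<Phi>\<close> on the test element
  supported on \<open>{0, a, b, a + b}\<close> has, by rigidity, the same scalars in these four degrees, and for an
  automorphism they are multiplicative.\<close>

lemma local_imp_automorphism:
  fixes \<Phi> :: "('f::field_char_0, 'n::finite) witt \<Rightarrow> ('f, 'n) witt"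
  assumes "local_lie_automorphism witt_scale witt_bracket \<Phi>"
  shows "lie_automorphism witt_scale witt_bracket \<Phi>"
proof -
  have lin: "Vector_Spaces.linear witt_scale witt_scale \<Phi>"
    and loc: "\<And>x. \<exists>\<theta>. lie_automorphism witt_scale witt_bracket \<theta> \<and> \<Phi> x = \<theta> x"
    using assms by (simp_all add: local_lie_automorphism_def)
  have add: "\<Phi> (x + y) = \<Phi> x + \<Phi> y" for x y using lin by (simp add: linear_witt_iff)
  have inj: "inj \<Phi>"
  proof (rule injI)
    fix x y assume eq: "\<Phi> x = \<Phi> y"
    obtain \<theta> where \<theta>: "lie_automorphism witt_scale witt_bracket \<theta>" "\<Phi> (x - y) = \<theta> (x - y)"
      using loc by blast
    have "\<Phi> (x - y) = 0" using add[of "x - y" y] eq by simp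
    then have "\<theta> (x - y) = \<theta> 0" using \<theta> lie_automorphismD(6)[OF \<theta>(1)] by simp
    then have "x - y = 0" by (rule injD[OF lie_automorphismD(4)[OF \<theta>(1)]])
    then show "x = y" by simp
  qed
  obtain A \<tau> \<kappa> where form: "graded_form \<Phi> A \<tau> \<kappa>"
    using local_graded_form[OF lin inj loc] by blast
  have "\<kappa> (a + b) = \<kappa> a * \<kappa> b" for a b
  proof -
    define S where "S = {0, a, b, a + b}"
    have S: "finite S" "0 \<in> S" by (simp_all add: S_def)
    obtain h :: "'f ^ 'n" where h: "separates h S" using ex_separates[OF S(1)] by blast
    obtain \<theta> where aut: "lie_automorphism witt_scale witt_bracket \<theta>"
      and eq: "\<Phi> (\<Sum>s\<in>S. wterm s h) = \<theta> (\<Sum>s\<in>S. wterm s h)" using loc by blast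
    obtain A' \<tau>' \<kappa>' where form': "graded_form \<theta> A' \<tau>' \<kappa>'"
      and hom: "\<And>a b. \<kappa>' (a + b) = \<kappa>' a * \<kappa>' b"
      using automorphism_graded_form[OF aut] by blast
    have "\<kappa> s = \<kappa>' s" if "s \<in> S" for s
      using graded_form_rigid(2)[OF form form' add lie_automorphismD(1)[OF aut] S h eq that] by simp
    then show ?thesis using hom by (simp add: S_def)
  qed
  then show ?thesis by (rule automorphism_if_graded_form[OF lin inj form])
qed

theorem corollary3p7:
  fixes \<Phi> :: "('f::field_char_0, 'n::finite) witt \<Rightarrow> ('f, 'n) witt"
  shows "(two_local_lie_automorphism witt_scale witt_bracket \<Phi> \<longrightarrow>
            lie_automorphism witt_scale witt_bracket \<Phi>) \<and>
         (local_lie_automorphism witt_scale witt_bracket \<Phi> \<longrightarrow>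
            lie_automorphism witt_scale witt_bracket \<Phi>)"
  using two_local_imp_automorphism local_imp_automorphism by blast

end
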